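(* For every $\epsilon \in [0, \frac{1}{4}]$, every $n$-node unweighted undirected graph $G = (V,E)$ has a subgraph $H$ on the same vertex set $V$ with $\tilde{O}(n^{1+\epsilon})$ edges such that for all $u,v \in V$, $$\delta_G(u,v) \le \delta_H(u,v) \le \delta_G(u,v) + \tilde{O}(n^{2/3 - 5\epsilon/3}),$$ where the hidden polylogarithmic factors and constants do not depend on $G$.
   Context: All graphs are undirected and unweighted with $n$ nodes. $\delta_G(u,v)$ denotes the shortest-path distance between $u$ and $v$ in $G$. The notation $\tilde{O}(g(n))$ means $O(g(n)\cdot \mathrm{polylog}\, n)$. *)

theory Defs
  imports Complex_Main "HOL-Library.Extended_Nat"
begin

definition is_graph :: "nat \<Rightarrow> (nat \<times> nat) set \<Rightarrow> bool" where
  "is_graph n E \<longleftrightarrow> E \<subseteq> {..<n} \<times> {..<n} \<and> sym E \<and> irrefl E"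

fun is_walk :: "(nat \<times> nat) set \<Rightarrow> nat list \<Rightarrow> bool" where
  "is_walk E [] = False"
| "is_walk E [x] = True"
| "is_walk E (x # y # xs) = ((x, y) \<in> E \<and> is_walk E (y # xs))"

text \<open>Shortest-path distance (number of edges); infinity if no path.\<close>

definition dist :: "(nat \<times> nat) set \<Rightarrow> nat \<Rightarrow> nat \<Rightarrow> enat" where
  "dist E u v = (INF xs \<in> {xs. is_walk E xs \<and> hd xs = u \<and> last xs = v}.
                    enat (length xs - 1))"

definition num_edges :: "(nat \<times> nat) set \<Rightarrow> nat" where
  "num_edges E = card {{u, v} | u v. (u, v) \<in> E}"

end

theory Submission
  imports Defs "HOL-Analysis.Convex"
begin

text \<open>
  Fix a radius \<open>R \<approx> n\<^sup>\<rho>\<close> with \<open>\<rho> = 2/3 - 5\<epsilon>/3\<close>. The vertices are covered by cores \<open>W\<close> such that the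
  \<open>R\<close>-neighbourhoods of the cores have total size \<open>O(n)\<close> and diameter \<open>O*(R)\<close>, where \<open>O*\<close> hides
  polylogarithmic factors. Among the spheres of radius at
  most \<open>R\<close> around \<open>W\<close> one contains at most a \<open>1/R\<close> fraction of the neighbourhood. If the neighbourhood
  has size \<open>s\<close> with \<open>s\<^sup>3 \<le> R\<^sup>4n\<^bsup>2\<epsilon>\<^esup>\<close>, then a Coppersmith-Elkin pairwise distance preserver for this sphere,
  taken inside it, has only \<open>O(s n\<^sup>\<epsilon>)\<close> edges. Once these preservers are bought, a shortest path
  that misses as few edges as possible misses edges only near its endpoints and inside the few large clusters.
  Adding a multiplicative \<open>O(log n)\<close>-spanner makes the error near the endpoints \<open>O*(R)\<close>. Finally, paths
  whose error is too large are bought one at a time; each such path touching \<open>m\<close> large clusters costs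
  \<open>O*(m R)\<close> edges and fixes the distances for at least \<open>m/2\<close> new pairs of large clusters, so the total cost
  is \<open>O*(R L\<^sup>2)\<close> for \<open>L\<close> large clusters, which is \<open>O*(n\<^bsup>1+\<epsilon>\<^esup>)\<close> for \<open>\<epsilon> \<le> 1/4\<close>.
\<close>

subsection \<open>Walks, neighbourhoods and shortest paths\<close>

text \<open>Distance bounds are phrased as existence of walks of length at most \<open>k\<close>, so
  unreachable pairs need no infinite value; \<open>dist_le_iff_near\<close> translates back to
  \<open>dist\<close>.\<close>

definition near :: "('a \<times> 'a) set \<Rightarrow> nat \<Rightarrow> 'a \<Rightarrow> 'a \<Rightarrow> bool" where
  "near E k x y \<longleftrightarrow> (\<exists>j\<le>k. (x, y) \<in> E ^^ j)"

lemma near_refl [simp]: "near E k x x"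
  unfolding near_def by (rule exI[of _ 0]) simp

lemma near_0_iff [simp]: "near E 0 x y \<longleftrightarrow> x = y"
  by (auto simp: near_def)

lemma near_edge: "(x, y) \<in> E \<Longrightarrow> near E 1 x y"
  unfolding near_def by (rule exI[of _ 1]) simp

lemma near_mono:
  assumes "near E k x y" "E \<subseteq> F" "k \<le> l"
  shows "near F l x y"
proof -
  from assms(1) obtain j where j: "j \<le> k" "(x, y) \<in> E ^^ j"
    by (auto simp: near_def)
  have "(x, y) \<in> F ^^ j"
    using j(2) assms(2) unfolding relpow_fun_conv by blast
  with j(1) assms(3) show ?thesis
    unfolding near_def by (meson le_trans)
qed

lemma near_trans:
  assumes "near E k x y" "near E l y z"
  shows "near E (k + l) x z"
proof -
  obtain i j where ij: "i \<le> k" "(x, y) \<in> E ^^ i" "j \<le> l" "(y, z) \<in> E ^^ j"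
    using assms by (auto simp: near_def)
  then have "(x, z) \<in> E ^^ (i + j)" by (auto simp: relpow_add)
  with add_mono[OF ij(1,3)] show ?thesis by (auto simp: near_def)
qed

lemma near_sym:
  assumes "sym E" "near E k x y"
  shows "near E k y x"
proof -
  have "(y, x) \<in> E ^^ j" if "(x, y) \<in> E ^^ j" for j x y
    using that
  proof (induction j arbitrary: x)
    case (Suc j)
    then obtain z where "(x, z) \<in> E" "(z, y) \<in> E ^^ j"
      by (meson relpow_Suc_D2)
    with Suc.IH assms(1) show ?case
      by (auto dest: symD)
  qed simp
  with assms(2) show ?thesis
    by (auto simp: near_def)
qed

lemma near_Suc_cases:
  assumes "near E (Suc k) x y"
  obtains "near E k x y" | z where "near E k x z" "(z, y) \<in> E"
proof -
  from assms obtain j where j: "j \<le> Suc k" "(x, y) \<in> E ^^ j"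
    by (auto simp: near_def)
  show ?thesis
  proof (cases "j \<le> k")
    case True
    with j that(1) show ?thesis by (auto simp: near_def)
  next
    case False
    with j have "(x, y) \<in> E ^^ Suc k" by (simp add: le_Suc_eq)
    then obtain z where "(x, z) \<in> E ^^ k" "(z, y) \<in> E" by auto
    with that(2) show ?thesis by (auto simp: near_def)
  qed
qed

lemma near_step: "near E k x y \<Longrightarrow> (y, z) \<in> E \<Longrightarrow> near E (Suc k) x z"
  using near_trans[OF _ near_edge] by fastforce

lemma near_subset:
  assumes "near E k x y" "E \<subseteq> V \<times> V" "x \<in> V"
  shows "y \<in> V"
  using assms(1)
proof (induction k arbitrary: y)
  case 0
  with assms(3) show ?case by simp
next
  case (Suc k)
  then show ?case
    using assms(2) by (elim near_Suc_cases) auto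
qed

lemma near_along:
  assumes "\<And>i. a \<le> i \<Longrightarrow> i < b \<Longrightarrow> (f i, f (Suc i)) \<in> E" "a \<le> b"
  shows "near E (b - a) (f a) (f b)"
  using assms(2,1)
proof (induction b rule: dec_induct)
  case (step m)
  then show ?case
    by (simp add: Suc_diff_le near_step)
qed simp

section \<open>Neighbourhoods of vertex sets\<close>

definition nbhd :: "('a \<times> 'a) set \<Rightarrow> nat \<Rightarrow> 'a set \<Rightarrow> 'a set" where
  "nbhd E k W = {x. \<exists>w\<in>W. near E k w x}"

lemma nbhd_0 [simp]: "nbhd E 0 W = W"
  by (auto simp: nbhd_def)

lemma nbhd_mono: "W \<subseteq> W' \<Longrightarrow> k \<le> l \<Longrightarrow> nbhd E k W \<subseteq> nbhd E l W'"
  by (auto simp: nbhd_def intro: near_mono[OF _ order_refl])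

lemma nbhd_subset: "E \<subseteq> V \<times> V \<Longrightarrow> W \<subseteq> V \<Longrightarrow> nbhd E k W \<subseteq> V"
  by (auto simp: nbhd_def subset_iff intro: near_subset)

lemma nbhd_step: "x \<in> nbhd E k W \<Longrightarrow> (x, y) \<in> E \<Longrightarrow> y \<in> nbhd E (Suc k) W"
  by (auto simp: nbhd_def intro: near_step)

section \<open>Shortest paths\<close>

definition geodesic :: "('a \<times> 'a) set \<Rightarrow> nat \<Rightarrow> (nat \<Rightarrow> 'a) \<Rightarrow> bool" where
  "geodesic E d f \<longleftrightarrow>
    (\<forall>i<d. (f i, f (Suc i)) \<in> E) \<and> (\<forall>k. near E k (f 0) (f d) \<longrightarrow> d \<le> k)"

lemma geodesic_near:
  assumes "geodesic E d f" "a \<le> b" "b \<le> d"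
  shows "near E (b - a) (f a) (f b)"
  using assms by (intro near_along) (auto simp: geodesic_def)

text \<open>A shortcut between \<open>f a\<close> and \<open>f b\<close>, completed by the two outer
  pieces, would be too short a walk between the ends.\<close>

lemma geodesic_le:
  assumes "geodesic E d f" "a \<le> b" "b \<le> d" "near E k (f a) (f b)"
  shows "b - a \<le> k"
proof -
  have "near E (a + k + (d - b)) (f 0) (f d)"
    using near_trans[OF near_trans[OF geodesic_near[OF assms(1), of 0 a] assms(4)]
        geodesic_near[OF assms(1), of b d]] assms(2,3) by simp
  with assms(1) have "d \<le> a + k + (d - b)"
    by (simp add: geodesic_def)
  with assms show ?thesis by linarith
qed

lemma geodesic_inj:
  assumes "geodesic E d f"
  shows "inj_on f {..d}"
proof (rule linorder_inj_onI)
  fix a b assume "a < b" "a \<in> {..d}" "b \<in> {..d}"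
  then show "f a \<noteq> f b"
    using geodesic_le[OF assms, of a b 0] by auto
qed auto

section \<open>Missing edges and lean geodesics\<close>

definition missing :: "('a \<times> 'a) set \<Rightarrow> nat \<Rightarrow> (nat \<Rightarrow> 'a) \<Rightarrow> nat set" where
  "missing H d f = {i. i < d \<and> (f i, f (Suc i)) \<notin> H}"

lemma finite_missing [simp]: "finite (missing H d f)"
  by (simp add: missing_def)

text \<open>Minimality is relative to the current subgraph \<open>H\<close>, so a lean path uses
  \<open>H\<close> wherever \<open>H\<close> offers an equally short route.\<close>

definition lean :: "('a \<times> 'a) set \<Rightarrow> ('a \<times> 'a) set \<Rightarrow> nat \<Rightarrow> (nat \<Rightarrow> 'a) \<Rightarrow> bool" where
  "lean E H d f \<longleftrightarrow> geodesic E d f \<and>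
    (\<forall>g. geodesic E d g \<and> g 0 = f 0 \<and> g d = f d \<longrightarrow>
      card (missing H d f) \<le> card (missing H d g))"

lemma lean_exists:
  assumes "near E k u v"
  obtains d f where "d \<le> k" "lean E H d f" "f 0 = u" "f d = v"
proof -
  define d where "d = (LEAST j. (u, v) \<in> E ^^ j)"
  from assms obtain j where j: "j \<le> k" "(u, v) \<in> E ^^ j"
    by (auto simp: near_def)
  have "(u, v) \<in> E ^^ d"
    unfolding d_def using j(2) by (rule LeastI)
  then obtain g0 where g0: "g0 0 = u" "g0 d = v" "\<forall>i<d. (g0 i, g0 (Suc i)) \<in> E"
    by (auto simp: relpow_fun_conv)
  have least: "d \<le> i" if "near E i u v" for i
    using that by (auto simp: near_def d_def intro: Least_le le_trans)
  define P where "P g \<longleftrightarrow> geodesic E d g \<and> g 0 = u \<and> g d = v" for g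
  have "P g0" using g0 least by (auto simp: P_def geodesic_def)
  then obtain f where f: "P f" "\<And>g. P g \<Longrightarrow> card (missing H d f) \<le> card (missing H d g)"
    using ex_has_least_nat[of P g0 "\<lambda>g. card (missing H d g)"] by blast
  then have "lean E H d f" "f 0 = u" "f d = v"
    by (auto simp: lean_def P_def)
  moreover have "d \<le> k" using least assms by blast
  ultimately show thesis using that by blast
qed

text \<open>Exchange argument: rerouting the segment through \<open>H\<close> keeps length and ends
  but would remove a missing edge, against leanness.\<close>

lemma lean_no_missing:
  assumes lean: "lean E H d f" and "H \<subseteq> E" and ab: "a \<le> b" "b \<le> d"
    and H: "near H (b - a) (f a) (f b)"
  shows "missing H d f \<inter> {a..<b} = {}"
proof (rule ccontr)
  assume "\<not> ?thesis"
  then obtain i where i: "i \<in> missing H d f" "a \<le> i" "i < b" by auto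
  have geo: "geodesic E d f" using lean by (simp add: lean_def)
  obtain j where j: "j \<le> b - a" "(f a, f b) \<in> H ^^ j"
    using H by (auto simp: near_def)
  then have "near H j (f a) (f b)" by (auto simp: near_def)
  then have "near E j (f a) (f b)" using \<open>H \<subseteq> E\<close> by (rule near_mono) simp
  \<comment> \<open>The walk in \<open>H\<close> is also a walk in \<open>E\<close>, so it cannot be
    shorter than the geodesic segment; having exactly \<open>b - a\<close> edges, it fits into the
    same index range.\<close>
  with j(1) geodesic_le[OF geo ab] have "j = b - a" by fastforce
  with j obtain h where h: "h 0 = f a" "h (b - a) = f b"
    "\<And>i. i < b - a \<Longrightarrow> (h i, h (Suc i)) \<in> H"
    by (auto simp: relpow_fun_conv)
  define g where "g k = (if a \<le> k \<and> k \<le> b then h (k - a) else f k)" for k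
  have inside: "(g k, g (Suc k)) \<in> H" if "a \<le> k" "k < b" for k
    using that h(3)[of "k - a"] by (simp add: g_def Suc_diff_le)
  have outside: "g k = f k \<and> g (Suc k) = f (Suc k)" if "\<not> (a \<le> k \<and> k < b)" for k
    using that h(1,2) ab by (auto simp: g_def not_le not_less le_Suc_eq)
  have ends: "g 0 = f 0" "g d = f d"
    using h(1,2) ab by (auto simp: g_def)
  have "(g k, g (Suc k)) \<in> E" if "k < d" for k
  proof (cases "a \<le> k \<and> k < b")
    case True
    with inside \<open>H \<subseteq> E\<close> show ?thesis by blast
  next
    case False
    with outside geo that show ?thesis by (simp add: geodesic_def)
  qed
  then have "geodesic E d g"
    using geo ends by (simp add: geodesic_def)
  with lean ends have "card (missing H d f) \<le> card (missing H d g)"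
    by (simp add: lean_def)
  moreover have "missing H d g \<subset> missing H d f"
  proof
    show "missing H d g \<subseteq> missing H d f"
    proof
      fix k assume "k \<in> missing H d g"
      then have k: "k < d" "(g k, g (Suc k)) \<notin> H" by (auto simp: missing_def)
      with inside have "\<not> (a \<le> k \<and> k < b)" by blast
      with outside k show "k \<in> missing H d f" by (simp add: missing_def)
    qed
    show "missing H d g \<noteq> missing H d f"
      using i inside[of i] by (auto simp: missing_def)
  qed
  ultimately show False
    using psubset_card_mono[OF finite_missing] by (metis not_le)
qed

text \<open>Both orientations are inserted because graphs are symmetric relations; this is the
  factor 2 in \<open>card_add_path\<close>.\<close>

definition add_path :: "('a \<times> 'a) set \<Rightarrow> nat \<Rightarrow> (nat \<Rightarrow> 'a) \<Rightarrow> ('a \<times> 'a) set" where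
  "add_path H d f = H \<union> (\<lambda>i. (f i, f (Suc i))) ` missing H d f
    \<union> (\<lambda>i. (f (Suc i), f i)) ` missing H d f"

lemma subset_add_path: "H \<subseteq> add_path H d f"
  by (auto simp: add_path_def)

lemma sym_add_path: "sym H \<Longrightarrow> sym (add_path H d f)"
  by (auto simp: add_path_def sym_def)

lemma add_path_subset: "H \<subseteq> E \<Longrightarrow> sym E \<Longrightarrow> geodesic E d f \<Longrightarrow> add_path H d f \<subseteq> E"
  by (auto simp: add_path_def missing_def geodesic_def dest: symD)

lemma card_add_path: "finite H \<Longrightarrow> card (add_path H d f) \<le> card H + 2 * card (missing H d f)"
  unfolding add_path_def
  using card_Un_le[of "H \<union> (\<lambda>i. (f i, f (Suc i))) ` missing H d f" "(\<lambda>i. (f (Suc i), f i)) ` missing H d f"]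
    card_Un_le[of H "(\<lambda>i. (f i, f (Suc i))) ` missing H d f"]
    card_image_le[OF finite_missing, of "\<lambda>i. (f i, f (Suc i))" H d f]
    card_image_le[OF finite_missing, of "\<lambda>i. (f (Suc i), f i)" H d f]
  by linarith

lemma near_add_path: "a \<le> b \<Longrightarrow> b \<le> d \<Longrightarrow> near (add_path H d f) (b - a) (f a) (f b)"
  by (rule near_along) (auto simp: add_path_def missing_def)

section \<open>Distance preservation for a pair\<close>

definition preserves :: "('a \<times> 'a) set \<Rightarrow> ('a \<times> 'a) set \<Rightarrow> 'a \<Rightarrow> 'a \<Rightarrow> bool" where
  "preserves E H x y \<longleftrightarrow> (\<forall>k. near E k x y \<longrightarrow> near H k x y)"

lemma preserves_mono: "preserves E H x y \<Longrightarrow> H \<subseteq> H' \<Longrightarrow> preserves E H' x y"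
  by (metis near_mono order_refl preserves_def)

lemma geodesic_preserves:
  assumes "geodesic E d f" "sym E" "sym H" "a \<le> d" "b \<le> d"
    and H: "\<And>a b. a \<le> b \<Longrightarrow> b \<le> d \<Longrightarrow> near H (b - a) (f a) (f b)"
  shows "preserves E H (f a) (f b)"
  unfolding preserves_def
proof (intro allI impI)
  have *: "near H k (f a) (f b)" if "near E k (f a) (f b)" "a \<le> b" "b \<le> d" for a b k
    using near_mono[OF H[OF that(2,3)] order_refl geodesic_le[OF assms(1) that(2,3,1)]] .
  fix k assume k: "near E k (f a) (f b)"
  show "near H k (f a) (f b)"
  proof (cases "a \<le> b")
    case True
    with *[OF k] assms(5) show ?thesis by simp
  next
    case False
    with *[OF near_sym[OF assms(2) k]] assms(4) have "near H k (f b) (f a)" by simp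
    with assms(3) show ?thesis by (rule near_sym)
  qed
qed

subsection \<open>Path buying\<close>

lemma near_stretch:
  assumes "near E k x y" "\<And>x y. (x, y) \<in> E \<Longrightarrow> near H m x y"
  shows "near H (m * k) x y"
  using assms(1)
proof (induction k arbitrary: y)
  case (Suc k)
  from Suc.prems show ?case
  proof (cases rule: near_Suc_cases)
    case 1
    from Suc.IH[OF this] show ?thesis by (rule near_mono) auto
  next
    case (2 z)
    from near_trans[OF Suc.IH[OF 2(1)] assms(2)[OF 2(2)]] show ?thesis
      by (simp add: add.commute)
  qed
qed simp

text \<open>Every missing edge is replaced by a detour of length at most \<open>m\<close>; its own
  step stays in the count, which only loosens the bound.\<close>

lemma near_detours:
  assumes "geodesic E d f" "\<And>x y. (x, y) \<in> E \<Longrightarrow> near H m x y" "a \<le> b" "b \<le> d"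
  shows "near H ((b - a) + m * card (missing H d f \<inter> {a..<b})) (f a) (f b)"
  using assms(3,4)
proof (induction b rule: dec_induct)
  case (step b)
  then have IH: "near H ((b - a) + m * card (missing H d f \<inter> {a..<b})) (f a) (f b)" by simp
  have split: "{a..<Suc b} = insert b {a..<b}" using step.hyps by auto
  show ?case
  proof (cases "b \<in> missing H d f")
    case True
    then have "card (missing H d f \<inter> {a..<Suc b}) = Suc (card (missing H d f \<inter> {a..<b}))"
      by (simp add: split Int_insert_right)
    moreover have "near H m (f b) (f (Suc b))"
      using assms(1) step.prems by (intro assms(2)) (simp add: geodesic_def)
    ultimately show ?thesis
      using near_mono[OF near_trans[OF IH] order_refl] step.hyps by (simp add: Suc_diff_le)
  next
    case False
    then have "missing H d f \<inter> {a..<Suc b} = missing H d f \<inter> {a..<b}"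
      by (simp add: split)
    moreover have "(f b, f (Suc b)) \<in> H"
      using False step.prems by (simp add: missing_def)
    ultimately show ?thesis
      using near_step[OF IH] step.hyps by (simp add: Suc_diff_le)
  qed
qed simp

lemma card_le_if_diameter_le:
  fixes I :: "nat set"
  assumes "finite I" "\<And>i j. i \<in> I \<Longrightarrow> j \<in> I \<Longrightarrow> i \<le> j \<Longrightarrow> j - i \<le> D"
  shows "card I \<le> D + 1"
proof (cases "I = {}")
  case False
  then have "Min I \<in> I" using assms(1) by simp
  then have "I \<subseteq> {Min I..Min I + D}"
    using assms by (fastforce simp: le_diff_conv)
  from card_mono[OF _ this] show ?thesis by simp
qed simp

lemma card_ends_le: "card ({..D} \<union> {d - D..<d}) \<le> 2 * D + 1"
  using card_Un_le[of "{..D}" "{d - D..<d}"] by simp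

text \<open>Quantifying over all \<open>L\<close> between \<open>H\<close> and \<open>E\<close>
  keeps the property usable after any number of paths has been bought.\<close>

definition confined :: "('a \<times> 'a) set \<Rightarrow> ('a \<times> 'a) set \<Rightarrow> nat \<Rightarrow> 'a set set \<Rightarrow> bool" where
  "confined E H D \<L> \<longleftrightarrow> (\<forall>L d f i. H \<subseteq> L \<and> L \<subseteq> E \<and> lean E L d f \<and> i \<in> missing L d f \<longrightarrow>
    i \<le> D \<or> d - i \<le> D \<or> (\<exists>W\<in>\<L>. f i \<in> W))"

lemma confinedD:
  assumes "confined E H D \<L>" "H \<subseteq> L" "L \<subseteq> E" "lean E L d f" "i \<in> missing L d f"
  obtains "i \<le> D" | "d - i \<le> D" | W where "W \<in> \<L>" "f i \<in> W"
  using assms unfolding confined_def by metis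

text \<open>A geodesic meets a set of diameter \<open>D\<close> in at most \<open>D + 1\<close>
  indices, and confinement leaves only such indices and those near the ends.\<close>

lemma card_missing_le:
  assumes lean: "lean E H d f" and confined: "confined E H0 D \<L>"
    and H: "H0 \<subseteq> H" "H \<subseteq> E" and "finite \<L>"
    and diameter: "\<forall>W\<in>\<L>. \<forall>x\<in>W. \<forall>y\<in>W. near E D x y"
  shows "card (missing H d f) \<le> 2 * (D + 1) + card {W \<in> \<L>. \<exists>i\<le>d. f i \<in> W} * (D + 1)"
proof -
  define \<T> where "\<T> = {W \<in> \<L>. \<exists>i\<le>d. f i \<in> W}"
  define Ends where "Ends = {..D} \<union> {d - D..<d}"
  have geo: "geodesic E d f" using lean by (simp add: lean_def)
  have fin: "finite \<T>" "finite Ends" using \<open>finite \<L>\<close> by (auto simp: \<T>_def Ends_def)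
  have cEnds: "card Ends \<le> 2 * (D + 1)" using card_ends_le[of D d] by (simp add: Ends_def)
  have "card {i. i \<le> d \<and> f i \<in> W} \<le> D + 1" if "W \<in> \<T>" for W
  proof (rule card_le_if_diameter_le)
    fix i j assume "i \<in> {i. i \<le> d \<and> f i \<in> W}" "j \<in> {i. i \<le> d \<and> f i \<in> W}" "i \<le> j"
    then show "j - i \<le> D"
      using geodesic_le[OF geo, of i j D] diameter[rule_format, of W "f i" "f j"] that
      by (simp add: \<T>_def)
  qed simp
  then have "(\<Sum>W\<in>\<T>. card {i. i \<le> d \<and> f i \<in> W}) \<le> card \<T> * (D + 1)"
    using sum_bounded_above[of \<T> "\<lambda>W. card {i. i \<le> d \<and> f i \<in> W}" "D + 1"] by simp
  moreover have "missing H d f \<subseteq> Ends \<union> (\<Union>W\<in>\<T>. {i. i \<le> d \<and> f i \<in> W})"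
  proof
    fix i assume i: "i \<in> missing H d f"
    then have "i < d" by (simp add: missing_def)
    from confinedD[OF confined H lean i]
    show "i \<in> Ends \<union> (\<Union>W\<in>\<T>. {i. i \<le> d \<and> f i \<in> W})"
    proof cases
      case 1
      then show ?thesis by (simp add: Ends_def)
    next
      case 2
      with \<open>i < d\<close> have "d - D \<le> i" by linarith
      with \<open>i < d\<close> show ?thesis by (simp add: Ends_def)
    next
      case (3 W)
      with \<open>i < d\<close> have "W \<in> \<T>" "i \<in> {i. i \<le> d \<and> f i \<in> W}"
        unfolding \<T>_def using less_imp_le by blast+
      then show ?thesis by blast
    qed
  qed
  then have "card (missing H d f) \<le> card Ends + card (\<Union>W\<in>\<T>. {i. i \<le> d \<and> f i \<in> W})"
    using card_mono[of "Ends \<union> (\<Union>W\<in>\<T>. {i. i \<le> d \<and> f i \<in> W})" "missing H d f"] fin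
      card_Un_le[of Ends "\<Union>W\<in>\<T>. {i. i \<le> d \<and> f i \<in> W}"] by simp
  moreover have "card (\<Union>W\<in>\<T>. {i. i \<le> d \<and> f i \<in> W}) \<le> (\<Sum>W\<in>\<T>. card {i. i \<le> d \<and> f i \<in> W})"
    by (rule card_UN_le[OF fin(1)])
  ultimately show ?thesis
    unfolding \<T>_def[symmetric] using cEnds by (meson add_mono le_trans)
qed

text \<open>Instead of running a buying procedure, \<open>H\<close> is chosen with the most happy
  pairs among the subgraphs that spend at most \<open>12 * (D + 1)\<close> ordered edges per happy
  pair. A vertex pair with too large an error would yield a path whose purchase stays within this
  budget and makes more pairs happy.\<close>

lemma path_buying:
  assumes "finite E" "sym E" and H0: "H0 \<subseteq> E" "sym H0" and "finite \<L>"
    and diameter: "\<forall>W\<in>\<L>. \<forall>x\<in>W. \<forall>y\<in>W. near E D x y"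
    and stretch: "\<forall>x y. (x, y) \<in> E \<longrightarrow> near H0 m x y"
    and confined: "confined E H0 D \<L>"
  shows "\<exists>H\<subseteq>E. sym H \<and> card H \<le> card H0 + 12 * (D + 1) * (card \<L>)\<^sup>2
    \<and> (\<forall>k u v. near E k u v \<longrightarrow> near H (k + 4 * (m + 1) * (2 * D + 1)) u v)"
proof -
  note diam = diameter[rule_format]
  \<comment> \<open>Going over from the given points to a bought path costs \<open>2 * D\<close> in
    the length of the comparison walk in \<open>E\<close> and \<open>2 * (m * D)\<close> for the
    moves in the subgraph.\<close>
  define Q where "Q = 2 * D + 2 * (m * D)"
  \<comment> \<open>A pair of clusters is happy if it needs no further path. Happiness persists when edges are added,
    and a bought path makes all pairs of clusters on it happy.\<close>
  define happy where "happy H = {(W, W'). W \<in> \<L> \<and> W' \<in> \<L> \<and>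
    (\<forall>x\<in>W. \<forall>y\<in>W'. \<forall>k. near E k x y \<longrightarrow> near H (k + Q) x y)}" for H
  define good where "good H \<longleftrightarrow> H0 \<subseteq> H \<and> H \<subseteq> E \<and> sym H \<and>
    card H \<le> card H0 + 12 * (D + 1) * card (happy H)" for H
  have happy_sub: "happy H \<subseteq> \<L> \<times> \<L>" for H by (auto simp: happy_def)
  then have fin_happy: "finite (happy H)" for H
    using \<open>finite \<L>\<close> finite_subset by blast
  have card_happy: "card (happy H) \<le> (card \<L>)\<^sup>2" for H
    using card_mono[OF _ happy_sub] \<open>finite \<L>\<close>
    by (simp add: card_cartesian_product power2_eq_square)
  have "good H0" using H0 by (simp add: good_def)
  then obtain H where H: "good H" "\<And>H'. good H' \<Longrightarrow> card (happy H') \<le> card (happy H)"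
    using ex_has_greatest_nat[of good H0 "\<lambda>H. card (happy H)" "Suc ((card \<L>)\<^sup>2)"] card_happy
    by (auto simp: less_Suc_eq_le)
  then have HE: "H0 \<subseteq> H" "H \<subseteq> E" "sym H" by (auto simp: good_def)
  have stretchL: "near L m x y" if "H0 \<subseteq> L" "(x, y) \<in> E" for L x y
    using near_mono[OF stretch[rule_format, OF that(2)] that(1) order_refl] .
  have inW: "near L (m * D) x y" if "H0 \<subseteq> L" "W \<in> \<L>" "x \<in> W" "y \<in> W" for L W x y
    using near_stretch[OF diam[OF that(2-4)] stretchL[OF that(1)]] .
  have "near H (k + 4 * (m + 1) * (2 * D + 1)) u v" if kuv: "near E k u v" for k u v
  proof (rule ccontr)
    assume bad: "\<not> near H (k + 4 * (m + 1) * (2 * D + 1)) u v"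
    have too_near: False if "near H j u v" "j \<le> k + 4 * (m + 1) * (2 * D + 1)" for j
      using near_mono[OF that(1) order_refl that(2)] bad by contradiction
    obtain d f where f: "d \<le> k" "lean E H d f" "f 0 = u" "f d = v"
      using lean_exists[OF kuv] by metis
    then have geo: "geodesic E d f" by (simp add: lean_def)
    define M where "M = missing H d f"
    define Ends where "Ends = {..D} \<union> {d - D..<d}"
    define Idx where "Idx = {i. i \<le> d \<and> (\<exists>W\<in>\<L>. f i \<in> W)}"
    define \<T> where "\<T> = {W \<in> \<L>. \<exists>i\<le>d. f i \<in> W}"
    have cEnds: "card Ends \<le> 2 * D + 1" unfolding Ends_def by (rule card_ends_le)
    have finEnds: "finite Ends" by (simp add: Ends_def)
    have Md: "i < d" if "i \<in> M" for i using that by (simp add: M_def missing_def)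
    have loc: "i \<in> Ends \<or> i \<in> Idx" if "i \<in> M" for i
      using confinedD[OF confined HE(1,2) f(2) that[unfolded M_def]] Md[OF that]
      by cases (auto simp: Ends_def Idx_def)
    \<comment> \<open>The spare index \<open>b'\<close> admits the missing edge that may start at
      \<open>q\<close>, the first index of \<open>{q..<d}\<close>; elsewhere it is set to
      \<open>0\<close>, already in \<open>Ends\<close>.\<close>
    have detour: "near H ((b - a) + m * (2 * D + 2)) (f a) (f b)"
      if "a \<le> b" "b \<le> d" "M \<inter> {a..<b} \<subseteq> insert b' Ends" for a b b'
    proof -
      have "card (M \<inter> {a..<b}) \<le> card (insert b' Ends)"
        using that(3) finEnds by (intro card_mono) auto
      also have "\<dots> \<le> 2 * D + 2" using cEnds by (simp add: card_insert_if finEnds)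
      finally have le: "(b - a) + m * card (M \<inter> {a..<b}) \<le> (b - a) + m * (2 * D + 2)"
        by (intro add_left_mono mult_le_mono2)
      show ?thesis
        by (rule near_mono[OF near_detours[OF geo stretchL[OF HE(1)] that(1,2), folded M_def]
              order_refl le])
    qed
    have "Idx \<noteq> {}"
    proof
      assume "Idx = {}"
      then have "M \<inter> {0..<d} \<subseteq> insert 0 Ends" using loc by auto
      then have "near H (d - 0 + m * (2 * D + 2)) u v" using detour[of 0 d 0] f by simp
      moreover have "d - 0 + m * (2 * D + 2) \<le> k + 4 * (m + 1) * (2 * D + 1)"
        using f(1) by (simp add: algebra_simps)
      ultimately show False by (rule too_near)
    qed
    have finIdx: "finite Idx" by (simp add: Idx_def)
    \<comment> \<open>The first and last index on a cluster: before \<open>p\<close> and after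
      \<open>q\<close> only edges near the ends are missing.\<close>
    define p q where "p = Min Idx" and "q = Max Idx"
    have pq: "p \<in> Idx" "q \<in> Idx" using finIdx \<open>Idx \<noteq> {}\<close> by (auto simp: p_def q_def)
    have pq_le: "p \<le> i" "i \<le> q" if "i \<in> Idx" for i
      using finIdx that by (auto simp: p_def q_def)
    obtain A where A: "A \<in> \<L>" "f p \<in> A" and pd: "p \<le> d" using pq(1) by (auto simp: Idx_def)
    obtain B where B: "B \<in> \<L>" "f q \<in> B" and qd: "q \<le> d" using pq(2) by (auto simp: Idx_def)
    have "A \<in> \<T>" "B \<in> \<T>" using A B pd qd by (auto simp: \<T>_def)
    have start: "near H (p + m * (2 * D + 2)) u (f p)"
    proof -
      have "M \<inter> {0..<p} \<subseteq> insert 0 Ends" using loc pq_le(1) by (fastforce simp: not_less)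
      then show ?thesis using detour[of 0 p 0] pd f(3) by simp
    qed
    have finish: "near H ((d - q) + m * (2 * D + 2)) (f q) v"
    proof -
      have "M \<inter> {q..<d} \<subseteq> insert q Ends" using loc pq_le(2) by fastforce
      then show ?thesis using detour[of q d q] qd f(4) by simp
    qed
    \<comment> \<open>Otherwise the route through \<open>A\<close>, \<open>W\<close> and \<open>B\<close> would already be short enough.\<close>
    have unhappy: "(A, W) \<notin> happy H \<or> (W, B) \<notin> happy H" if WT: "W \<in> \<T>" for W
    proof (rule ccontr)
      assume "\<not> ?thesis"
      then have hh: "(A, W) \<in> happy H" "(W, B) \<in> happy H" by auto
      obtain c where c: "c \<le> d" "f c \<in> W" using WT by (auto simp: \<T>_def)
      have pcq: "p \<le> c" "c \<le> q" using pq_le[of c] c WT by (auto simp: Idx_def \<T>_def)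
      have "near H (c - p + Q) (f p) (f c)"
        using hh(1) A(2) c(2) geodesic_near[OF geo pcq(1) c(1)] by (simp add: happy_def)
      moreover have "near H (q - c + Q) (f c) (f q)"
        using hh(2) B(2) c(2) geodesic_near[OF geo pcq(2) qd] by (simp add: happy_def)
      ultimately have "near H ((p + m * (2 * D + 2)) + ((c - p + Q) + (q - c + Q))
          + ((d - q) + m * (2 * D + 2))) u v"
        by (intro near_trans[OF near_trans[OF start near_trans] finish])
      \<comment> \<open>The error of two outer detours and two happy segments is
        \<open>2 * m * (2 * D + 2) + 2 * Q\<close>, that is
        \<open>8 * m * D + 4 * m + 4 * D\<close>.\<close>
      moreover have "(p + m * (2 * D + 2)) + ((c - p + Q) + (q - c + Q)) + ((d - q) + m * (2 * D + 2))
          \<le> k + 4 * (m + 1) * (2 * D + 1)"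
        using pcq qd f(1) by (simp add: Q_def algebra_simps)
      ultimately show False by (rule too_near)
    qed
    define H' where "H' = add_path H d f"
    have H': "H \<subseteq> H'" "H' \<subseteq> E" "sym H'"
      using subset_add_path add_path_subset[OF HE(2) \<open>sym E\<close> geo] sym_add_path[OF HE(3)]
      by (simp_all add: H'_def)
    have H0H': "H0 \<subseteq> H'" using HE(1) H'(1) by blast
    have old: "happy H \<subseteq> happy H'"
    proof -
      have "near H' j x y" if "near H j x y" for j x y
        using near_mono[OF that H'(1) order_refl] .
      then show ?thesis unfolding happy_def by auto
    qed
    have new: "(W, W') \<in> happy H'" if W: "W \<in> \<T>" "W' \<in> \<T>" for W W'
    proof -
      have WL: "W \<in> \<L>" "W' \<in> \<L>" using W by (auto simp: \<T>_def)
      obtain a b where ab: "a \<le> d" "f a \<in> W" "b \<le> d" "f b \<in> W'" using W by (auto simp: \<T>_def)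
      have pres: "preserves E H' (f a) (f b)"
        using near_add_path H'(3) ab(1,3)
        by (intro geodesic_preserves[OF geo \<open>sym E\<close>]) (auto simp: H'_def)
      have "near H' (j + Q) x y" if xy: "x \<in> W" "y \<in> W'" "near E j x y" for x y j
      proof -
        have "near E (D + j + D) (f a) (f b)"
          using near_trans[OF near_trans[OF diam[OF WL(1) ab(2) xy(1)] xy(3)] diam[OF WL(2) xy(2) ab(4)]] .
        then have "near H' (D + j + D) (f a) (f b)" using pres by (simp add: preserves_def)
        then have "near H' (m * D + (D + j + D) + m * D) x y"
          by (rule near_trans[OF near_trans[OF inW[OF H0H' WL(1) xy(1) ab(2)]]
              inW[OF H0H' WL(2) ab(4) xy(2)]])
        then show ?thesis by (rule near_mono) (simp_all add: Q_def)
      qed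
      with WL show ?thesis by (simp add: happy_def)
    qed
    define N where "N = happy H' - happy H"
    have finN: "finite N" using fin_happy by (simp add: N_def)
    have fin\<T>: "finite \<T>" using \<open>finite \<L>\<close> by (simp add: \<T>_def)
    \<comment> \<open>Each cluster on the path was unhappy with \<open>A\<close> or with
      \<open>B\<close> and is now happy with both, so it is counted by a new pair.\<close>
    have "\<T> \<subseteq> {W. (A, W) \<in> N} \<union> {W. (W, B) \<in> N}"
      using unhappy new \<open>A \<in> \<T>\<close> \<open>B \<in> \<T>\<close> by (auto simp: N_def)
    moreover have finAB: "finite {W. (A, W) \<in> N}" "finite {W. (W, B) \<in> N}"
      using finite_vimageI[OF finN, of "\<lambda>W. (A, W)"] finite_vimageI[OF finN, of "\<lambda>W. (W, B)"]
      by (auto simp: vimage_def inj_def)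
    ultimately have "card \<T> \<le> card {W. (A, W) \<in> N} + card {W. (W, B) \<in> N}"
      using card_mono[of "{W. (A, W) \<in> N} \<union> {W. (W, B) \<in> N}" \<T>]
        card_Un_le[of "{W. (A, W) \<in> N}" "{W. (W, B) \<in> N}"] by simp
    also have "\<dots> \<le> card N + card N"
      by (intro add_mono card_inj_on_le[OF _ _ finN, of "\<lambda>W. (A, W)"]
          card_inj_on_le[OF _ _ finN, of "\<lambda>W. (W, B)"]) (auto simp: inj_on_def)
    finally have \<T>N: "card \<T> \<le> 2 * card N" by simp
    have \<T>1: "1 \<le> card \<T>"
      using fin\<T> \<open>A \<in> \<T>\<close> by (metis One_nat_def Suc_leI card_gt_0_iff empty_iff)
    \<comment> \<open>As \<open>\<T>\<close> is nonempty, the edges near the ends can be charged to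
      it as well: \<open>3 * (D + 1)\<close> missing edges per cluster, hence
      \<open>6 * (D + 1)\<close> per new pair, and twice that for both orientations.\<close>
    have "card M \<le> 2 * (D + 1) + card \<T> * (D + 1)"
      unfolding M_def \<T>_def
      by (rule card_missing_le[OF f(2) confined HE(1,2) \<open>finite \<L>\<close> diameter])
    also have "\<dots> \<le> (2 * card \<T>) * (D + 1) + card \<T> * (D + 1)"
      using \<T>1 by (intro add_right_mono mult_right_mono) auto
    also have "\<dots> = 3 * (D + 1) * card \<T>" by (simp add: algebra_simps)
    also have "\<dots> \<le> 3 * (D + 1) * (2 * card N)" using \<T>N by (rule mult_le_mono2)
    finally have cM: "2 * card M \<le> 12 * (D + 1) * card N" by (simp add: algebra_simps)
    have sum_happy: "card (happy H') = card (happy H) + card N"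
      using card_Diff_subset[OF fin_happy old] card_mono[OF fin_happy old] by (simp add: N_def)
    have "finite H" using HE(2) \<open>finite E\<close> by (rule finite_subset)
    then have "card H' \<le> card H + 2 * card M" by (simp add: H'_def M_def card_add_path)
    also have "\<dots> \<le> card H0 + 12 * (D + 1) * card (happy H) + 12 * (D + 1) * card N"
      using H(1) cM by (intro add_mono) (simp_all add: good_def)
    also have "\<dots> = card H0 + 12 * (D + 1) * card (happy H')"
      by (simp add: sum_happy add_mult_distrib2)
    finally have "good H'" using H' H0H' by (simp add: good_def)
    from H(2)[OF this] sum_happy \<T>N \<T>1 show False by simp
  qed
  moreover have "card H \<le> card H0 + 12 * (D + 1) * (card \<L>)\<^sup>2"
    using H(1) card_happy[of H] unfolding good_def
    by (meson add_left_mono le_trans mult_le_mono2)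
  ultimately show ?thesis using HE by (intro exI[of _ H]) simp
qed

subsection \<open>Pairwise distance preservers\<close>

text \<open>Cauchy-Schwarz for the number \<open>k x\<close> of sets containing \<open>x\<close>:
  its squares sum to the sizes of all pairwise intersections, which are at most 2 off the
  diagonal.\<close>

lemma sum_card_overlap_bound:
  assumes "finite Y" "finite P" and X: "\<And>q. q \<in> P \<Longrightarrow> X q \<subseteq> Y"
    and overlap: "\<And>q r. q \<in> P \<Longrightarrow> r \<in> P \<Longrightarrow> q \<noteq> r \<Longrightarrow> card (X q \<inter> X r) \<le> 2"
  shows "(\<Sum>q\<in>P. card (X q))\<^sup>2 \<le> ((\<Sum>q\<in>P. card (X q)) + 2 * (card P)\<^sup>2) * card Y"
proof -
  define k where "k x = (\<Sum>q\<in>P. of_bool (x \<in> X q) :: nat)" for x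
  have cardX: "card A = (\<Sum>x\<in>Y. of_bool (x \<in> A))" if "A \<subseteq> Y" for A
    using that \<open>finite Y\<close> by (simp add: Int_absorb1)
  have total: "(\<Sum>q\<in>P. card (X q)) = (\<Sum>x\<in>Y. k x)"
    unfolding k_def by (subst sum.swap) (auto intro!: sum.cong simp: cardX[OF X])
  have "(\<Sum>x\<in>Y. (k x)\<^sup>2) = (\<Sum>x\<in>Y. \<Sum>q\<in>P. \<Sum>r\<in>P. of_bool (x \<in> X q \<inter> X r))"
    unfolding k_def power2_eq_square sum_product by (auto intro!: sum.cong)
  also have "\<dots> = (\<Sum>q\<in>P. \<Sum>r\<in>P. \<Sum>x\<in>Y. of_bool (x \<in> X q \<inter> X r))"
    by (subst sum.swap) (intro sum.cong refl sum.swap)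
  also have "\<dots> = (\<Sum>q\<in>P. \<Sum>r\<in>P. card (X q \<inter> X r))"
    by (intro sum.cong refl cardX[symmetric]) (use X in blast)
  also have "\<dots> \<le> (\<Sum>q\<in>P. \<Sum>r\<in>P. (if q = r then card (X q) else 0) + 2)"
  proof (intro sum_mono)
    fix q r assume "q \<in> P" "r \<in> P"
    with overlap[of q r] show "card (X q \<inter> X r) \<le> (if q = r then card (X q) else 0) + 2"
      by (cases "q = r") simp_all
  qed
  also have "\<dots> = (\<Sum>q\<in>P. card (X q)) + 2 * (card P)\<^sup>2"
    using \<open>finite P\<close> by (simp add: sum.distrib power2_eq_square del: add_2_eq_Suc')
  finally have squares: "(\<Sum>x\<in>Y. (k x)\<^sup>2) \<le> (\<Sum>q\<in>P. card (X q)) + 2 * (card P)\<^sup>2" .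
  have "(\<Sum>x\<in>Y. real (k x))\<^sup>2 \<le> (\<Sum>x\<in>Y. (real (k x))\<^sup>2) * real (card Y)"
    by (rule sum_squared_le_sum_of_squares)
  then have "real ((\<Sum>x\<in>Y. k x)\<^sup>2) \<le> real ((\<Sum>x\<in>Y. (k x)\<^sup>2) * card Y)"
    by simp
  then have "(\<Sum>x\<in>Y. k x)\<^sup>2 \<le> (\<Sum>x\<in>Y. (k x)\<^sup>2) * card Y"
    by (simp only: of_nat_le_iff)
  also have "\<dots> \<le> ((\<Sum>q\<in>P. card (X q)) + 2 * (card P)\<^sup>2) * card Y"
    using squares by simp
  finally show ?thesis by (simp add: total)
qed

text \<open>
  The paths are added greedily, each with as few new edges as possible, and \<open>X q\<close> collects the endpoints
  of the edges that are new for the pair \<open>q\<close>. Between two vertices of an older \<open>X r\<close> a path needs no new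
  edge, so only the first and the last such vertex can lie in \<open>X q\<close>. This replaces the usual
  consistent tie-breaking.
\<close>

lemma path_union_exists:
  assumes "finite P" and "finite Y" "E \<subseteq> Y \<times> Y" "sym E" "P \<subseteq> Y \<times> Y"
  shows "\<exists>H X. H \<subseteq> E \<and> sym H \<and> card H \<le> 2 * (\<Sum>q\<in>P. card (X q))
    \<and> (\<forall>(a, b)\<in>P. preserves E H a b)
    \<and> (\<forall>q\<in>P. X q \<subseteq> Y \<and> (\<forall>x\<in>X q. \<forall>y\<in>X q. preserves E H x y))
    \<and> (\<forall>q\<in>P. \<forall>r\<in>P. q \<noteq> r \<longrightarrow> card (X q \<inter> X r) \<le> 2)"
  using assms(1,5)
proof (induction P rule: finite_induct)
  case empty
  show ?case
    by (rule exI[of _ "{}"]) (auto simp: sym_def)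
next
  case (insert q P)
  have "P \<subseteq> Y \<times> Y" using insert.prems by simp
  from insert.IH[OF this] obtain H X where H: "H \<subseteq> E" "sym H" "card H \<le> 2 * (\<Sum>q\<in>P. card (X q))"
    and ball: "\<forall>(a, b)\<in>P. preserves E H a b"
      "\<forall>q\<in>P. X q \<subseteq> Y \<and> (\<forall>x\<in>X q. \<forall>y\<in>X q. preserves E H x y)"
      "\<forall>q\<in>P. \<forall>r\<in>P. q \<noteq> r \<longrightarrow> card (X q \<inter> X r) \<le> 2"
    by blast
  have pres: "preserves E H a b" if "(a, b) \<in> P" for a b
    using ball(1) that by blast
  have XY: "X q \<subseteq> Y" if "q \<in> P" for q
    using ball(2) that by blast
  have Xpres: "preserves E H x y" if "q \<in> P" "x \<in> X q" "y \<in> X q" for q x y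
    using ball(2) that by blast
  have overlap: "card (X q \<inter> X r) \<le> 2" if "q \<in> P" "r \<in> P" "q \<noteq> r" for q r
    using ball(3) that by blast
  obtain u v where q: "q = (u, v)" by (cases q)
  have upd: "(X(q := Z)) r = X r" if "r \<in> P" for r Z
    using that insert.hyps by auto
  have sum_upd: "(\<Sum>r\<in>insert q P. card ((X(q := Z)) r)) = card Z + (\<Sum>r\<in>P. card (X r))" for Z
  proof -
    have "(\<Sum>r\<in>P. card ((X(q := Z)) r)) = (\<Sum>r\<in>P. card (X r))"
      by (rule sum.cong) (simp_all only: upd)
    then show ?thesis
      using insert.hyps by (simp add: fun_upd_same del: fun_upd_apply)
  qed
  show ?case
  proof (cases "\<exists>k. near E k u v")
    \<comment> \<open>An unreachable pair is preserved vacuously and gets the empty set.\<close>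
    case False
    then have "preserves E H u v" by (simp add: preserves_def)
    then show ?thesis
      using H pres XY Xpres overlap sum_upd[of "{}"] insert.hyps
      by (intro exI[of _ H] exI[of _ "X(q := {})"]) (auto simp: q upd)
  next
    case True
    then obtain d f where f: "lean E H d f" "f 0 = u" "f d = v"
      using lean_exists by metis
    then have geo: "geodesic E d f" by (simp add: lean_def)
    define M where "M = missing H d f"
    define Z where "Z = f ` M \<union> f ` Suc ` M"
    define H' where "H' = add_path H d f"
    have finM: "finite M" by (simp add: M_def)
    have Md: "i < d" if "i \<in> M" for i using that by (simp add: M_def missing_def)
    have fY: "f i \<in> Y" if "i \<le> d" for i
      using near_subset[OF geodesic_near[OF geo, of 0 i] assms(3)] that f(2) insert.prems q by auto
    have Zidx: "Z = f ` (M \<union> Suc ` M)" by (auto simp: Z_def)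
    have idx: "i \<le> d" if "i \<in> M \<union> Suc ` M" for i using that Md by fastforce
    \<comment> \<open>A geodesic is injective, so distinct missing edges start at distinct vertices
      and \<open>Z\<close> pays for all of them.\<close>
    have "M \<subseteq> {..d}" using Md by fastforce
    then have "card M = card (f ` M)"
      using card_image[OF inj_on_subset[OF geodesic_inj[OF geo]]] by metis
    also have "\<dots> \<le> card Z"
      using finM by (intro card_mono) (auto simp: Z_def)
    finally have MZ: "card M \<le> card Z" .
    have H'E: "H' \<subseteq> E" "sym H'" "H \<subseteq> H'"
      using add_path_subset[OF H(1) assms(4) geo] sym_add_path[OF H(2)] subset_add_path
      by (simp_all add: H'_def)
    have "finite H" using H(1) assms(2,3) by (meson finite_SigmaI finite_subset)
    then have "card H' \<le> card H + 2 * card Z"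
      using card_add_path[of H d f] MZ by (simp add: H'_def M_def)
    then have cardH': "card H' \<le> 2 * (\<Sum>r\<in>insert q P. card ((X(q := Z)) r))"
      using H(3) sum_upd[of Z] by linarith
    have pf: "preserves E H' (f a) (f b)" if "a \<le> d" "b \<le> d" for a b
      using near_add_path that H'E by (intro geodesic_preserves[OF geo assms(4)]) (auto simp: H'_def)
    have new: "card (Z \<inter> X r) \<le> 2" if r: "r \<in> P" for r
    proof (cases "Z \<inter> X r = {}")
      case False
      define I where "I = {i \<in> M \<union> Suc ` M. f i \<in> X r}"
      have I: "finite I" "I \<noteq> {}" "Z \<inter> X r = f ` I"
        using False finM by (auto simp: I_def Zidx)
      define a b where "a = Min I" and "b = Max I"
      have ab: "a \<in> I" "b \<in> I" "\<And>i. i \<in> I \<Longrightarrow> a \<le> i \<and> i \<le> b"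
        using I by (auto simp: a_def b_def)
      then have abd: "a \<le> b" "b \<le> d" using idx by (auto simp: I_def)
      have "near H (b - a) (f a) (f b)"
        using Xpres[OF r, of "f a" "f b"] ab geodesic_near[OF geo abd]
        by (auto simp: I_def preserves_def)
      from lean_no_missing[OF f(1) H(1) abd this] have gap: "M \<inter> {a..<b} = {}"
        by (simp add: M_def)
      have "I \<subseteq> {a, b}"
      proof
        fix i assume i: "i \<in> I"
        with ab have "a \<le> i" "i \<le> b" by auto
        from i consider "i \<in> M" | j where "i = Suc j" "j \<in> M" by (auto simp: I_def)
        then show "i \<in> {a, b}"
          using gap \<open>a \<le> i\<close> \<open>i \<le> b\<close> by cases (force simp: disjoint_iff le_Suc_eq)+
      qed
      then have "card I \<le> card {a, b}" by (intro card_mono) auto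
      also have "\<dots> \<le> 2" by (simp add: card_insert_if)
      finally show ?thesis
        using card_image_le[OF I(1), of f] I(3) by simp
    qed simp
    have "\<forall>(a, b)\<in>insert q P. preserves E H' a b"
      using pf[of 0 d] f(2,3) pres preserves_mono[OF _ H'E(3)] by (auto simp: q)
    moreover have "\<forall>r\<in>insert q P. (X(q := Z)) r \<subseteq> Y \<and>
        (\<forall>x\<in>(X(q := Z)) r. \<forall>y\<in>(X(q := Z)) r. preserves E H' x y)"
    proof (intro ballI)
      fix r assume "r \<in> insert q P"
      then consider "r = q" | "r \<in> P" by blast
      then show "(X(q := Z)) r \<subseteq> Y \<and>
        (\<forall>x\<in>(X(q := Z)) r. \<forall>y\<in>(X(q := Z)) r. preserves E H' x y)"
      proof cases
        case 1
        then show ?thesis using fY idx pf by (auto simp: Zidx simp del: image_Un)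
      next
        case 2
        then show ?thesis
          using XY Xpres preserves_mono[OF _ H'E(3)] insert.hyps(2) by auto
      qed
    qed
    moreover have "\<forall>r\<in>insert q P. \<forall>s\<in>insert q P. r \<noteq> s \<longrightarrow>
        card ((X(q := Z)) r \<inter> (X(q := Z)) s) \<le> 2"
      using new overlap by (auto simp: Int_commute)
    ultimately show ?thesis
      using H'E cardH' by blast
  qed
qed

text \<open>Taking all pairs of \<open>A\<close> turns the squared number of pairs into
  \<open>card A ^ 4\<close>. Solved for \<open>K\<close>, the quadratic bound is the
  Coppersmith-Elkin size, of order \<open>card Y + (card A)\<^sup>2 * sqrt (card Y)\<close>.\<close>

lemma pairwise_preserver:
  assumes "finite Y" "E \<subseteq> Y \<times> Y" "sym E" "A \<subseteq> Y"
  obtains H K where "H \<subseteq> E" "sym H" "card H \<le> 2 * K"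
    "K\<^sup>2 \<le> (K + 2 * (card A) ^ 4) * card Y"
    "\<And>a b. a \<in> A \<Longrightarrow> b \<in> A \<Longrightarrow> preserves E H a b"
proof -
  have fin: "finite (A \<times> A)" using assms finite_subset by blast
  have "A \<times> A \<subseteq> Y \<times> Y" using assms(4) by blast
  from path_union_exists[OF fin assms(1-3) this]
  obtain H X where H: "H \<subseteq> E" "sym H" "card H \<le> 2 * (\<Sum>q\<in>A \<times> A. card (X q))"
    "\<forall>(a, b)\<in>A \<times> A. preserves E H a b"
    "\<forall>q\<in>A \<times> A. X q \<subseteq> Y \<and> (\<forall>x\<in>X q. \<forall>y\<in>X q. preserves E H x y)"
    "\<forall>q\<in>A \<times> A. \<forall>r\<in>A \<times> A. q \<noteq> r \<longrightarrow> card (X q \<inter> X r) \<le> 2"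
    by (elim exE conjE)
  have "(\<Sum>q\<in>A \<times> A. card (X q))\<^sup>2 \<le>
      ((\<Sum>q\<in>A \<times> A. card (X q)) + 2 * (card (A \<times> A))\<^sup>2) * card Y"
    using H(5,6) by (intro sum_card_overlap_bound assms fin) blast+
  also have "(card (A \<times> A))\<^sup>2 = card A ^ 4"
    by (simp add: card_cartesian_product power2_eq_square power4_eq_xxxx)
  finally show thesis using that H by blast
qed

subsection \<open>Spanners and sparse covers\<close>

text \<open>A quantity that doubled at all \<open>J\<close> steps would reach \<open>2 ^ J\<close>.
  This selects the stopping radius in both ball-growing arguments.\<close>

lemma doubling_fails:
  fixes g :: "nat \<Rightarrow> nat"
  assumes "1 \<le> g 0" "g J < 2 ^ J"
  obtains j where "j < J" "g (Suc j) \<le> 2 * g j"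
proof -
  have "2 ^ j \<le> g j" if "\<forall>i<j. 2 * g i < g (Suc i)" for j
    using that
  proof (induction j)
    case (Suc j)
    then have "2 ^ j \<le> g j" "2 * g j < g (Suc j)" by simp_all
    then show ?case by simp
  qed (use assms in simp)
  with assms(2) have "\<not> (\<forall>i<J. 2 * g i < g (Suc i))"
    using not_le by blast
  with that show thesis using not_le by blast
qed

text \<open>Breadth-first layers: each vertex of a new layer is joined to one parent in the previous
  ball, at the price of two ordered pairs.\<close>

lemma bfs_tree:
  assumes "finite V" "E \<subseteq> V \<times> V" "sym E" "v \<in> V"
  shows "\<exists>T\<subseteq>E. sym T \<and> card T \<le> 2 * card (nbhd E k {v}) \<and> (\<forall>x\<in>nbhd E k {v}. near T k v x)"
proof (induction k)
  case 0
  show ?case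
    by (rule exI[of _ "{}"]) (auto simp: sym_def)
next
  case (Suc k)
  then obtain T where T: "T \<subseteq> E" "sym T" "card T \<le> 2 * card (nbhd E k {v})"
    "\<And>x. x \<in> nbhd E k {v} \<Longrightarrow> near T k v x"
    by blast
  define N where "N = nbhd E (Suc k) {v} - nbhd E k {v}"
  have "\<forall>x\<in>N. \<exists>p. p \<in> nbhd E k {v} \<and> (p, x) \<in> E"
    by (auto simp: N_def nbhd_def elim!: near_Suc_cases)
  then obtain p where p: "\<And>x. x \<in> N \<Longrightarrow> p x \<in> nbhd E k {v} \<and> (p x, x) \<in> E"
    by metis
  define T' where "T' = T \<union> (\<lambda>x. (p x, x)) ` N \<union> (\<lambda>x. (x, p x)) ` N"
  have sub: "nbhd E k {v} \<subseteq> nbhd E (Suc k) {v}" by (rule nbhd_mono) auto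
  have finB: "finite (nbhd E (Suc k) {v})"
    using nbhd_subset[OF assms(2)] assms(1,4) by (meson empty_subsetI finite_subset insert_subset)
  then have finN: "finite N" by (simp add: N_def)
  have "card T' \<le> card T + card N + card N"
    unfolding T'_def
    using card_Un_le[of "T \<union> (\<lambda>x. (p x, x)) ` N" "(\<lambda>x. (x, p x)) ` N"]
      card_Un_le[of T "(\<lambda>x. (p x, x)) ` N"]
      card_image_le[OF finN, of "\<lambda>x. (p x, x)"] card_image_le[OF finN, of "\<lambda>x. (x, p x)"]
    by linarith
  also have "\<dots> \<le> 2 * (card (nbhd E k {v}) + card N)"
    using T(3) by simp
  also have "card (nbhd E k {v}) + card N = card (nbhd E (Suc k) {v})"
    unfolding N_def using sub finB by (metis card_Diff_subset card_mono finite_subset le_add_diff_inverse)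
  finally have "card T' \<le> 2 * card (nbhd E (Suc k) {v})" .
  moreover have "T' \<subseteq> E"
    using T(1) p assms(3) by (auto simp: T'_def dest: symD)
  moreover have "sym T'"
    using T(2) by (auto simp: T'_def sym_def)
  moreover have "near T' (Suc k) v x" if "x \<in> nbhd E (Suc k) {v}" for x
  proof (cases "x \<in> N")
    case True
    with p have "near T k v (p x)" by (intro T(4)) blast
    then have "near T' k v (p x)" by (rule near_mono) (auto simp: T'_def)
    then show ?thesis by (rule near_step) (use True in \<open>auto simp: T'_def\<close>)
  next
    case False
    with that have "near T k v x" by (intro T(4)) (auto simp: N_def)
    then show ?thesis by (rule near_mono) (auto simp: T'_def)
  qed
  ultimately show ?case by blast
qed

text \<open>Ball carving: a tree on the ball of radius \<open>Suc r\<close> serves every edge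
  touching the ball of radius \<open>r\<close>, which is then removed. The larger ball is at most
  twice as big, so four ordered pairs per removed vertex pay for the tree, and \<open>r < J\<close>
  gives the stretch.\<close>

lemma log_spanner:
  assumes "finite V" "sym E" "card V < 2 ^ J"
  shows "\<exists>H\<subseteq>E. sym H \<and> H \<subseteq> V \<times> V \<and> card H \<le> 4 * card V \<and>
    (\<forall>(x, y)\<in>E \<inter> V \<times> V. near H (2 * J) x y)"
  using assms(1,3)
proof (induction V rule: finite_psubset_induct)
  case (psubset V)
  show ?case
  proof (cases "V = {}")
    case True
    then show ?thesis by (intro exI[of _ "{}"]) (auto simp: sym_def)
  next
    case False
    then obtain v where v: "v \<in> V" by blast
    define F where "F = E \<inter> V \<times> V"
    have F: "F \<subseteq> V \<times> V" "sym F" using assms(2) by (auto simp: F_def sym_def)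
    have inV: "nbhd F k {v} \<subseteq> V" for k using nbhd_subset[OF F(1)] v by blast
    then have fin: "finite (nbhd F k {v})" for k using psubset.hyps(1) finite_subset by blast
    have "card (nbhd F J {v}) < 2 ^ J"
      using card_mono[OF psubset.hyps(1) inV] psubset.prems by (meson le_less_trans)
    then obtain r where r: "r < J" "card (nbhd F (Suc r) {v}) \<le> 2 * card (nbhd F r {v})"
      by (rule doubling_fails[of "\<lambda>k. card (nbhd F k {v})", rotated]) simp_all
    obtain T where T: "T \<subseteq> F" "sym T" "card T \<le> 2 * card (nbhd F (Suc r) {v})"
      "\<And>x. x \<in> nbhd F (Suc r) {v} \<Longrightarrow> near T (Suc r) v x"
      using bfs_tree[OF psubset.hyps(1) F v, of "Suc r"] by blast
    define V' where "V' = V - nbhd F r {v}"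
    have v_in: "v \<in> nbhd F r {v}" by (simp add: nbhd_def)
    then have "V' \<subset> V" using v by (auto simp: V'_def)
    moreover have "card V' < 2 ^ J"
      using psubset_card_mono[OF psubset.hyps(1) \<open>V' \<subset> V\<close>] psubset.prems by linarith
    ultimately have "\<exists>H\<subseteq>E. sym H \<and> H \<subseteq> V' \<times> V' \<and> card H \<le> 4 * card V' \<and>
      (\<forall>(x, y)\<in>E \<inter> V' \<times> V'. near H (2 * J) x y)"
      by (rule psubset.IH)
    then obtain H where H: "H \<subseteq> E" "sym H" "H \<subseteq> V' \<times> V'" "card H \<le> 4 * card V'"
      "\<forall>(x, y)\<in>E \<inter> V' \<times> V'. near H (2 * J) x y"
      by (elim exE conjE)
    have "card (H \<union> T) \<le> 4 * card V' + 4 * card (nbhd F r {v})"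
      using card_Un_le[of H T] H(4) T(3) r(2) by linarith
    also have "\<dots> = 4 * card V"
      using card_Diff_subset[OF fin inV] card_mono[OF psubset.hyps(1) inV, of r]
      by (simp add: V'_def)
    finally have "card (H \<union> T) \<le> 4 * card V" .
    moreover have "near (H \<union> T) (2 * J) x y" if xy: "(x, y) \<in> F" for x y
    proof -
      have tree: "near (H \<union> T) (2 * J) x y"
        if "x \<in> nbhd F (Suc r) {v}" "y \<in> nbhd F (Suc r) {v}" for x y
        using near_mono[OF near_trans[OF near_sym[OF T(2) T(4)[OF that(1)]] T(4)[OF that(2)]],
            of "H \<union> T" "2 * J"] r(1) by simp
      consider "x \<in> nbhd F r {v}" | "y \<in> nbhd F r {v}" | "x \<in> V'" "y \<in> V'"
        using xy F by (auto simp: V'_def)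
      then show ?thesis
      proof cases
        case 1
        then have "x \<in> nbhd F (Suc r) {v}" using nbhd_mono[of "{v}" "{v}" r "Suc r" F] by auto
        with tree nbhd_step[OF 1 xy] show ?thesis by blast
      next
        case 2
        then have "y \<in> nbhd F (Suc r) {v}" using nbhd_mono[of "{v}" "{v}" r "Suc r" F] by auto
        with tree nbhd_step[OF 2 symD[OF F(2) xy]] show ?thesis by blast
      next
        case 3
        with H(5) xy have "near H (2 * J) x y" by (auto simp: F_def)
        then show ?thesis by (rule near_mono) auto
      qed
    qed
    moreover have "H \<union> T \<subseteq> E" "sym (H \<union> T)" "H \<union> T \<subseteq> V \<times> V"
      using H T F by (auto simp: F_def V'_def sym_Un)
    ultimately show ?thesis by (auto simp: F_def intro!: exI[of _ "H \<union> T"])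
  qed
qed

text \<open>Ball carving on the uncovered vertices \<open>U\<close> with radii growing by
  \<open>2 * R\<close>, while distances stay those of the whole graph. The neighbourhood of each
  chosen core is at most twice as large as a set \<open>Z j\<close>, and these sets are disjoint
  over all rounds.\<close>

lemma sparse_cover:
  assumes "finite V" "E \<subseteq> V \<times> V" "sym E" "card V < 2 ^ J" "U \<subseteq> V"
  shows "\<exists>\<W>. finite \<W> \<and> \<Union>\<W> = U
    \<and> (\<forall>W\<in>\<W>. \<forall>x\<in>nbhd E R W. \<forall>y\<in>nbhd E R W. near E ((4 * J + 2) * R) x y)
    \<and> (\<Sum>W\<in>\<W>. card (nbhd E R W)) \<le> 2 * card (nbhd E R U)"
  using finite_subset[OF assms(5,1)] assms(5)
proof (induction U rule: finite_psubset_induct)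
  case (psubset U)
  show ?case
  proof (cases "U = {}")
    case True
    then show ?thesis by (intro exI[of _ "{}"]) auto
  next
    case False
    then obtain v where v: "v \<in> U" by blast
    define C where "C j = U \<inter> nbhd E (2 * j * R) {v}" for j
    define Z where "Z j = nbhd E R (C j)" for j
    have ZV: "Z j \<subseteq> V" for j
      unfolding Z_def using psubset.prems by (intro nbhd_subset[OF assms(2)]) (auto simp: C_def)
    have finZ: "finite (Z j)" for j
      using finite_subset[OF ZV assms(1)] .
    have "v \<in> Z j" for j
      unfolding Z_def nbhd_def using v by (auto simp: C_def nbhd_def intro: bexI[of _ v])
    then have "1 \<le> card (Z 0)"
      using finZ[of 0] by (metis One_nat_def Suc_leI card_gt_0_iff empty_iff)
    moreover have "card (Z J) < 2 ^ J"
      using card_mono[OF assms(1) ZV] assms(4) by (meson le_less_trans)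
    ultimately obtain j where j: "j < J" "card (Z (Suc j)) \<le> 2 * card (Z j)"
      by (rule doubling_fails)
    define W where "W = C (Suc j)"
    define U' where "U' = U - W"
    have vW: "v \<in> W" using v by (auto simp: W_def C_def nbhd_def)
    have "U' \<subset> U" "U' \<subseteq> V" using v vW psubset.prems by (auto simp: U'_def)
    from psubset.IH[OF this] obtain \<W> where \<W>: "finite \<W>" "\<Union>\<W> = U'"
      "\<forall>W\<in>\<W>. \<forall>x\<in>nbhd E R W. \<forall>y\<in>nbhd E R W. near E ((4 * J + 2) * R) x y"
      "(\<Sum>W\<in>\<W>. card (nbhd E R W)) \<le> 2 * card (nbhd E R U')"
      by (elim exE conjE)
    have rad: "near E ((2 * J + 1) * R) v x" if x: "x \<in> nbhd E R W" for x
    proof -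
      obtain w where w: "near E (2 * Suc j * R) v w" "near E R w x"
        using x by (auto simp: W_def C_def nbhd_def)
      have "2 * Suc j * R + R \<le> (2 * J + 1) * R"
        using j(1) by (metis Suc_leI add_mult_distrib mult_1 add_le_mono1 mult_le_mono1 mult_le_mono2)
      with near_trans[OF w] show ?thesis by (rule near_mono[OF _ order_refl])
    qed
    have diam: "near E ((4 * J + 2) * R) x y" if "x \<in> nbhd E R W" "y \<in> nbhd E R W" for x y
      using near_trans[OF near_sym[OF assms(3) rad[OF that(1)]] rad[OF that(2)]]
      by (simp add: algebra_simps)
    \<comment> \<open>A later core close to \<open>Z j\<close> would already belong to \<open>W\<close>, so the sets \<open>Z j\<close> of all rounds are disjoint.\<close>
    have disj: "Z j \<inter> nbhd E R U' = {}"
    proof (rule ccontr)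
      assume "\<not> ?thesis"
      then obtain x w u where *: "near E (2 * j * R) v w" "near E R w x" "u \<in> U'" "near E R u x"
        by (auto simp: Z_def C_def nbhd_def)
      have "near E (2 * j * R + R + R) v u"
        using near_trans[OF near_trans[OF *(1,2)] near_sym[OF assms(3) *(4)]] .
      then have "near E (2 * Suc j * R) v u" by (simp add: algebra_simps)
      with *(3) show False by (auto simp: U'_def W_def C_def nbhd_def)
    qed
    have "(\<Sum>W\<in>insert W \<W>. card (nbhd E R W)) \<le> card (nbhd E R W) + (\<Sum>W\<in>\<W>. card (nbhd E R W))"
      using \<W>(1) by (simp add: sum.insert_if)
    also have "\<dots> \<le> 2 * (card (Z j) + card (nbhd E R U'))"
      using j(2) \<W>(4) by (simp add: W_def Z_def)
    also have "card (Z j) + card (nbhd E R U') = card (Z j \<union> nbhd E R U')"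
      using disj finZ finite_subset[OF nbhd_subset[OF assms(2)] assms(1), of U' R] psubset.prems
      by (subst card_Un_disjoint) (auto simp: U'_def)
    also have "\<dots> \<le> card (nbhd E R U)"
    proof (rule card_mono)
      show "finite (nbhd E R U)"
        using finite_subset[OF nbhd_subset[OF assms(2) psubset.prems] assms(1)] .
      show "Z j \<union> nbhd E R U' \<subseteq> nbhd E R U"
        using nbhd_mono[of "C j" U R R E] nbhd_mono[of U' U R R E]
        by (auto simp: Z_def C_def U'_def)
    qed
    finally have "(\<Sum>W\<in>insert W \<W>. card (nbhd E R W)) \<le> 2 * card (nbhd E R U)" by simp
    moreover have "\<Union>(insert W \<W>) = U"
      using \<W>(2) by (auto simp: U'_def W_def C_def)
    ultimately show ?thesis
      using \<W>(1,3) diam by (intro exI[of _ "insert W \<W>"]) simp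
  qed
qed

text \<open>The \<open>R\<close> successive spheres are disjoint parts of the neighbourhood, so not
  all of them can exceed the average.\<close>

lemma thin_sphere:
  assumes "finite (nbhd E R W)" "1 \<le> R"
  obtains t where "t < R" "card (nbhd E (Suc t) W - nbhd E t W) * R \<le> card (nbhd E R W)"
proof -
  let ?S = "\<lambda>t. card (nbhd E (Suc t) W - nbhd E t W)"
  have "(\<Sum>t<m. ?S t) \<le> card (nbhd E m W)" if "m \<le> R" for m
    using that
  proof (induction m)
    case (Suc m)
    have fin: "finite (nbhd E (Suc m) W)"
      using finite_subset[OF nbhd_mono assms(1)] Suc.prems by blast
    have sub: "nbhd E m W \<subseteq> nbhd E (Suc m) W" by (rule nbhd_mono) auto
    have "?S m + card (nbhd E m W) = card (nbhd E (Suc m) W)"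
      using card_Diff_subset[OF finite_subset[OF sub fin] sub] card_mono[OF fin sub] by simp
    with Suc show ?case by simp
  qed simp
  then have sum: "(\<Sum>t<R. ?S t) \<le> card (nbhd E R W)" by simp
  show thesis
  proof (rule ccontr)
    assume "\<not> thesis"
    with that have "\<forall>t<R. card (nbhd E R W) < ?S t * R" using not_le by blast
    then have "(\<Sum>t<R. card (nbhd E R W)) < (\<Sum>t<R. ?S t * R)"
      using assms(2) by (intro sum_strict_mono) (auto simp: lessThan_empty_iff)
    then have "R * card (nbhd E R W) < R * (\<Sum>t<R. ?S t)"
      by (simp add: sum_distrib_left mult.commute)
    with sum show False by simp
  qed
qed

subsection \<open>Clusters\<close>

text \<open>The bought edges preserve distances within \<open>C\<close> between vertices of a thin
  sphere \<open>A\<close>. A path through \<open>W\<close> with both ends outside the neighbourhood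
  crosses \<open>A\<close> before and after \<open>W\<close>, so by \<open>lean_no_missing\<close> a
  lean one misses nothing in between.\<close>

lemma cluster_preserver:
  fixes N :: real
  assumes "finite V" "E \<subseteq> V \<times> V" "sym E" "W \<subseteq> V" "1 \<le> R" "1 \<le> N"
    and small: "real (card (nbhd E R W)) ^ 3 \<le> real R ^ 4 * N\<^sup>2"
  shows "\<exists>H\<subseteq>E. sym H \<and> real (card H) \<le> 4 * N * card (nbhd E R W) \<and>
    (\<forall>L d f i. H \<subseteq> L \<longrightarrow> L \<subseteq> E \<longrightarrow> lean E L d f \<longrightarrow> i \<in> missing L d f \<longrightarrow> f i \<in> W \<longrightarrow>
      f 0 \<in> nbhd E R W \<or> f d \<in> nbhd E R W)"
proof -
  define s where "s = card (nbhd E R W)"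
  have finB: "finite (nbhd E k W)" for k
    using finite_subset[OF nbhd_subset[OF assms(2,4)] assms(1)] .
  obtain t where t: "t < R" "card (nbhd E (Suc t) W - nbhd E t W) * R \<le> s"
    unfolding s_def by (rule thin_sphere[OF finB assms(5)])
  define C where "C = nbhd E (Suc t) W"
  define A where "A = C - nbhd E t W"
  define F where "F = E \<inter> C \<times> C"
  have CR: "C \<subseteq> nbhd E R W"
    unfolding C_def using t(1) by (intro nbhd_mono) auto
  have F: "F \<subseteq> C \<times> C" "sym F" using assms(3) by (auto simp: F_def sym_def)
  have "A \<subseteq> C" by (auto simp: A_def)
  obtain H K where H: "H \<subseteq> F" "sym H" "card H \<le> 2 * K"
    and K: "K\<^sup>2 \<le> (K + 2 * (card A) ^ 4) * card C"
    and pres: "\<And>a b. a \<in> A \<Longrightarrow> b \<in> A \<Longrightarrow> preserves F H a b"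
    using pairwise_preserver[OF finB[of "Suc t", folded C_def] F \<open>A \<subseteq> C\<close>] by metis
  have "card C \<le> s" unfolding s_def using CR finB by (intro card_mono)
  with K have K': "K\<^sup>2 \<le> (K + 2 * (card A) ^ 4) * s"
    by (meson le_trans mult_le_mono2)
  \<comment> \<open>From \<open>card A \<le> s / R\<close> and
    \<open>s ^ 3 \<le> R ^ 4 * N\<^sup>2\<close> follows
    \<open>card A ^ 4 \<le> s * N\<^sup>2\<close>; this explains the threshold for small
    clusters.\<close>
  have "card A * R \<le> s" using t(2) by (simp add: A_def C_def)
  then have "real (card A) * real R \<le> real s" by (metis of_nat_le_iff of_nat_mult)
  then have "(real (card A) * real R) ^ 4 \<le> real s ^ 4" by (intro power_mono) auto
  also have "\<dots> = real s * real s ^ 3" by (simp add: eval_nat_numeral)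
  also have "\<dots> \<le> real s * (real R ^ 4 * N\<^sup>2)"
    using small by (intro mult_left_mono) (auto simp: s_def)
  finally have "real (card A) ^ 4 * real R ^ 4 \<le> (real s * N\<^sup>2) * real R ^ 4"
    by (simp add: power_mult_distrib mult_ac)
  then have cA: "real (card A) ^ 4 \<le> real s * N\<^sup>2"
    by (rule mult_right_le_imp_le) (use assms(5) in simp)
  \<comment> \<open>If \<open>K > 2 * s * N\<close>, then \<open>K - s > s * N\<close> because
    \<open>N \<ge> 1\<close>, and \<open>K * (K - s)\<close> exceeds what the quadratic bound
    allows.\<close>
  have "real K \<le> 2 * real s * N"
  proof (rule ccontr)
    assume "\<not> ?thesis"
    then have big: "2 * real s * N < real K" by simp
    have sN: "real s \<le> real s * N" using assms(6) by (simp add: mult_le_cancel_left1)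
    have "real (K\<^sup>2) \<le> real ((K + 2 * (card A) ^ 4) * s)" using K' of_nat_le_iff by blast
    then have "real K * real K \<le> (real K + 2 * real (card A) ^ 4) * real s"
      by (simp add: power2_eq_square)
    also have "\<dots> \<le> (real K + 2 * (real s * N\<^sup>2)) * real s"
      using cA by (intro mult_right_mono) auto
    finally have "real K * (real K - real s) \<le> 2 * (real s * N) * (real s * N)"
      by (simp add: algebra_simps power2_eq_square)
    moreover have "2 * (real s * N) * (real s * N) < real K * (real K - real s)"
      using big sN assms(6) by (intro mult_strict_mono') auto
    ultimately show False by simp
  qed
  with H(3) have "real (card H) \<le> 4 * N * s"
    by (simp add: mult_ac)
  moreover have "f 0 \<in> nbhd E R W \<or> f d \<in> nbhd E R W"
    if L: "H \<subseteq> L" "L \<subseteq> E" "lean E L d f" and i: "i \<in> missing L d f" and fi: "f i \<in> W"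
    for L d f i
  proof (rule ccontr)
    assume "\<not> ?thesis"
    with CR have out: "f 0 \<notin> C" "f d \<notin> C" by auto
    have "i < d" using i by (simp add: missing_def)
    have edge: "(f k, f (Suc k)) \<in> E" if "k < d" for k
      using L(3) that by (simp add: lean_def geodesic_def)
    \<comment> \<open>\<open>p\<close> is the last index up to \<open>i\<close>, and
      \<open>q\<close> below the first from \<open>i\<close> on, at which the path is outside
      \<open>C\<close>; their neighbours inside lie on the sphere.\<close>
    define I where "I = {k. k \<le> i \<and> f k \<notin> C}"
    define p where "p = Max I"
    have I: "finite I" "0 \<in> I" using out(1) by (auto simp: I_def)
    then have "p \<in> I" unfolding p_def by (intro Max_in) auto
    then have p: "p \<le> i" "f p \<notin> C" by (auto simp: I_def)
    have p_max: "f k \<in> C" if "k \<le> i" "p < k" for k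
    proof (rule ccontr)
      assume "f k \<notin> C"
      with that have "k \<in> I" by (simp add: I_def)
      with Max_ge[OF I(1)] that(2) show False by (simp add: p_def leD)
    qed
    define q where "q = (LEAST k. i \<le> k \<and> f k \<notin> C)"
    have d: "i \<le> d \<and> f d \<notin> C" using out(2) \<open>i < d\<close> by simp
    have q0: "i \<le> q \<and> f q \<notin> C"
      unfolding q_def using d by (rule LeastI)
    have "q \<le> d"
      unfolding q_def using d by (rule Least_le)
    have q: "f k \<in> C" if "i \<le> k" "k < q" for k
      using not_less_Least[of k "\<lambda>k. i \<le> k \<and> f k \<notin> C"] that by (auto simp: q_def)
    \<comment> \<open>\<open>C\<close> has radius at least 1, so the whole edge at \<open>i\<close>
      lies in \<open>C\<close> and belongs to the section from \<open>Suc p\<close> to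
      \<open>b\<close>.\<close>
    have fiC: "f i \<in> C" and fi1C: "f (Suc i) \<in> C"
    proof -
      have "f i \<in> nbhd E 0 W" using fi by simp
      then show "f (Suc i) \<in> C" "f i \<in> C"
        using nbhd_step[OF _ edge[OF \<open>i < d\<close>], of 0 W] nbhd_mono[of W W 0 "Suc t" E]
          nbhd_mono[of W W "Suc 0" "Suc t" E]
        by (auto simp: C_def)
    qed
    have "p < i" using p fiC le_neq_implies_less by metis
    have "Suc i < q" using q0 fiC fi1C by (metis Suc_leI le_neq_implies_less)
    define b where "b = q - 1"
    have qb: "q = Suc b" "i < b" "b < d" using \<open>Suc i < q\<close> \<open>q \<le> d\<close> by (auto simp: b_def)
    have inC: "f k \<in> C" if "Suc p \<le> k" "k \<le> b" for k
      using p_max[of k] q[of k] that qb(1) by (cases "k \<le> i") auto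
    have "f (Suc p) \<in> A"
      using inC[of "Suc p"] p(2) \<open>p < i\<close> qb nbhd_step[of "f (Suc p)" E t W "f p"]
        symD[OF assms(3) edge[of p]] \<open>i < d\<close> by (auto simp: A_def C_def)
    moreover have "f b \<in> A"
      using inC[of b] q0 \<open>p < i\<close> qb nbhd_step[of "f b" E t W "f q"] edge[of b]
      by (auto simp: A_def C_def)
    moreover have "near F (b - Suc p) (f (Suc p)) (f b)"
      using edge inC \<open>p < i\<close> qb by (intro near_along) (auto simp: F_def)
    ultimately have "near H (b - Suc p) (f (Suc p)) (f b)"
      using pres by (simp add: preserves_def)
    then have "near L (b - Suc p) (f (Suc p)) (f b)" by (rule near_mono[OF _ L(1) order_refl])
    from lean_no_missing[OF L(3,2) _ _ this] i \<open>p < i\<close> qb show False by auto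
  qed
  ultimately show ?thesis
    using H F_def by (intro exI[of _ H]) (auto simp: s_def)
qed

text \<open>The initial subgraph is the logarithmic spanner together with preservers for all small
  clusters. A missing edge in a small cluster forces an end of the path into that cluster's
  neighbourhood, whose diameter bounds the index distance to that end.\<close>

lemma backbone:
  fixes N :: real
  assumes "finite V" "E \<subseteq> V \<times> V" "sym E" "card V < 2 ^ J" "1 \<le> R" "1 \<le> N"
  shows "\<exists>H \<L>. H \<subseteq> E \<and> sym H \<and> real (card H) \<le> 4 * card V + 8 * N * card V
    \<and> finite \<L> \<and> (\<forall>W\<in>\<L>. real R ^ 4 * N\<^sup>2 < real (card (nbhd E R W)) ^ 3)
    \<and> (\<Sum>W\<in>\<L>. card (nbhd E R W)) \<le> 2 * card V
    \<and> (\<forall>W\<in>\<L>. \<forall>x\<in>W. \<forall>y\<in>W. near E ((4 * J + 2) * R) x y)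
    \<and> (\<forall>x y. (x, y) \<in> E \<longrightarrow> near H (2 * J) x y)
    \<and> confined E H ((4 * J + 2) * R) \<L>"
proof -
  let ?D = "(4 * J + 2) * R"
  obtain S where S: "S \<subseteq> E" "sym S" "card S \<le> 4 * card V"
    "\<forall>(x, y)\<in>E \<inter> V \<times> V. near S (2 * J) x y"
    using log_spanner[OF assms(1,3,4)] by (elim exE conjE)
  obtain \<W> where W: "finite \<W>" "\<Union>\<W> = V"
    "\<forall>W\<in>\<W>. \<forall>x\<in>nbhd E R W. \<forall>y\<in>nbhd E R W. near E ?D x y"
    "(\<Sum>W\<in>\<W>. card (nbhd E R W)) \<le> 2 * card (nbhd E R V)"
    using sparse_cover[OF assms(1-4) order_refl, of R] by (elim exE conjE)
  have "card (nbhd E R V) \<le> card V"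
    using nbhd_subset[OF assms(2) order_refl] assms(1) by (rule card_mono[rotated])
  with W(4) have total: "(\<Sum>W\<in>\<W>. card (nbhd E R W)) \<le> 2 * card V" by simp
  \<comment> \<open>Exactly the clusters that violate the size condition of
    \<open>cluster_preserver\<close>.\<close>
  define \<L> where "\<L> = {W \<in> \<W>. real R ^ 4 * N\<^sup>2 < real (card (nbhd E R W)) ^ 3}"
  have "\<forall>W\<in>\<W> - \<L>. \<exists>H\<subseteq>E. sym H \<and> real (card H) \<le> 4 * N * card (nbhd E R W) \<and>
    (\<forall>L d f i. H \<subseteq> L \<longrightarrow> L \<subseteq> E \<longrightarrow> lean E L d f \<longrightarrow> i \<in> missing L d f \<longrightarrow> f i \<in> W \<longrightarrow>
      f 0 \<in> nbhd E R W \<or> f d \<in> nbhd E R W)"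
    using W(2) by (intro ballI cluster_preserver[OF assms(1-3) _ assms(5,6)]) (auto simp: \<L>_def)
  from bchoice[OF this] obtain P where P_all: "\<forall>W\<in>\<W> - \<L>. P W \<subseteq> E \<and> sym (P W) \<and>
      real (card (P W)) \<le> 4 * N * card (nbhd E R W) \<and>
    (\<forall>L d f i. P W \<subseteq> L \<longrightarrow> L \<subseteq> E \<longrightarrow> lean E L d f \<longrightarrow> i \<in> missing L d f \<longrightarrow> f i \<in> W \<longrightarrow>
      f 0 \<in> nbhd E R W \<or> f d \<in> nbhd E R W)"
    by (elim exE)
  note P = bspec[OF P_all]
  define H where "H = S \<union> (\<Union>W\<in>\<W> - \<L>. P W)"
  have "card H \<le> card S + (\<Sum>W\<in>\<W> - \<L>. card (P W))"
    unfolding H_def using card_Un_le[of S "\<Union>W\<in>\<W> - \<L>. P W"] card_UN_le[of "\<W> - \<L>" P] W(1)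
    by (meson add_le_cancel_left finite_Diff le_trans)
  then have "real (card H) \<le> real (card S) + (\<Sum>W\<in>\<W> - \<L>. real (card (P W)))"
    by (metis of_nat_add of_nat_le_iff of_nat_sum)
  also have "\<dots> \<le> 4 * card V + (\<Sum>W\<in>\<W> - \<L>. 4 * N * card (nbhd E R W))"
    using S(3) P by (intro add_mono sum_mono) auto
  also have "\<dots> \<le> 4 * card V + (\<Sum>W\<in>\<W>. 4 * N * card (nbhd E R W))"
    using W(1) assms(6) by (intro add_left_mono sum_mono2) auto
  also have "\<dots> = 4 * card V + 4 * N * real (\<Sum>W\<in>\<W>. card (nbhd E R W))"
    by (simp add: sum_distrib_left)
  also have "\<dots> \<le> 4 * card V + 4 * N * real (2 * card V)"
    using assms(6) by (intro add_left_mono mult_left_mono of_nat_mono total) simp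
  finally have cardH: "real (card H) \<le> 4 * card V + 8 * N * card V" by simp
  have WR: "W \<subseteq> nbhd E R W" for W using nbhd_mono[of W W 0 R E] by simp
  have PE: "P W \<subseteq> E" "sym (P W)" if "W \<in> \<W> - \<L>" for W
    using P[OF that] by simp_all
  show ?thesis
  proof (intro exI[of _ H] exI[of _ \<L>] conjI)
    show "H \<subseteq> E" using S(1) PE(1) by (auto simp: H_def)
    show "sym H" unfolding H_def using S(2) PE(2) by (intro sym_Un sym_UNION) auto
    show "finite \<L>" using W(1) by (simp add: \<L>_def)
    show "(\<Sum>W\<in>\<L>. card (nbhd E R W)) \<le> 2 * card V"
      using total sum_mono2[of \<W> \<L> "\<lambda>W. card (nbhd E R W)"] W(1) by (auto simp: \<L>_def)
    show "\<forall>W\<in>\<L>. \<forall>x\<in>W. \<forall>y\<in>W. near E ?D x y"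
    proof (intro ballI)
      fix W x y assume "W \<in> \<L>" "x \<in> W" "y \<in> W"
      then have "W \<in> \<W>" "x \<in> nbhd E R W" "y \<in> nbhd E R W"
        using WR[of W] by (auto simp: \<L>_def)
      with W(3) show "near E ?D x y" by blast
    qed
    show "\<forall>x y. (x, y) \<in> E \<longrightarrow> near H (2 * J) x y"
    proof (intro allI impI)
      fix x y assume "(x, y) \<in> E"
      then have "near S (2 * J) x y" using S(4) assms(2) by auto
      then show "near H (2 * J) x y" by (rule near_mono) (auto simp: H_def)
    qed
    have "i \<le> ?D \<or> d - i \<le> ?D \<or> (\<exists>W\<in>\<L>. f i \<in> W)"
      if L: "H \<subseteq> L" "L \<subseteq> E" "lean E L d f" "i \<in> missing L d f" for L d f i
    proof -
      have geo: "geodesic E d f" and "i < d" using L by (auto simp: lean_def missing_def)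
      have "f i \<in> V" using geo \<open>i < d\<close> assms(2) by (auto simp: geodesic_def)
      then obtain W where "W \<in> \<W>" "f i \<in> W" using W(2) by blast
      show ?thesis
      proof (cases "W \<in> \<L>")
        case True
        with \<open>f i \<in> W\<close> show ?thesis by blast
      next
        case False
        with \<open>W \<in> \<W>\<close> have WS: "W \<in> \<W> - \<L>" by simp
        then have "P W \<subseteq> L" using L(1) by (auto simp: H_def)
        with P[OF WS] L \<open>f i \<in> W\<close> have "f 0 \<in> nbhd E R W \<or> f d \<in> nbhd E R W" by metis
        moreover have "near E ?D x y" if "x \<in> nbhd E R W" "y \<in> nbhd E R W" for x y
          using W(3) \<open>W \<in> \<W>\<close> that by simp
        ultimately have "near E ?D (f 0) (f i) \<or> near E ?D (f i) (f d)"
          using \<open>f i \<in> W\<close> WR by (meson subsetD)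
        then show ?thesis
          using geodesic_le[OF geo, of 0 i ?D] geodesic_le[OF geo, of i d ?D] \<open>i < d\<close> by auto
      qed
    qed
    then show "confined E H ?D \<L>" unfolding confined_def by metis
  qed (use cardH in \<open>auto simp: \<L>_def\<close>)
qed

subsection \<open>Distances and numerical bounds\<close>

lemma is_walk_relpow:
  "is_walk E xs \<Longrightarrow> (hd xs, last xs) \<in> E ^^ (length xs - 1)"
proof (induction E xs rule: is_walk.induct)
  case (3 E x y xs)
  then have "(x, y) \<in> E" "(y, last (y # xs)) \<in> E ^^ length xs" by simp_all
  then have "(x, last (y # xs)) \<in> E ^^ Suc (length xs)" by (rule relpow_Suc_I2)
  then show ?case by simp
qed simp_all

lemma relpow_is_walk:
  "(u, v) \<in> E ^^ k \<Longrightarrow> \<exists>xs. is_walk E xs \<and> hd xs = u \<and> last xs = v \<and> length xs = Suc k"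
proof (induction k arbitrary: u)
  case 0
  then show ?case by (intro exI[of _ "[u]"]) simp
next
  case (Suc k)
  then obtain w where w: "(u, w) \<in> E" "(w, v) \<in> E ^^ k" by (meson relpow_Suc_D2)
  from Suc.IH[OF w(2)] obtain xs where xs: "is_walk E xs" "hd xs = w" "last xs = v" "length xs = Suc k"
    by blast
  then obtain ys where "xs = w # ys" by (cases xs) auto
  with xs w show ?case by (intro exI[of _ "u # xs"]) simp
qed

lemma dist_le_iff_near: "dist E u v \<le> enat k \<longleftrightarrow> near E k u v"
proof
  assume "dist E u v \<le> enat k"
  \<comment> \<open>Strictness lets the infimum yield an actual walk.\<close>
  then have "dist E u v < enat (Suc k)"
    by (rule le_less_trans) simp
  then obtain xs where xs: "is_walk E xs" "hd xs = u" "last xs = v" "length xs - 1 < Suc k"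
    unfolding dist_def by (auto simp: INF_less_iff)
  then show "near E k u v"
    unfolding near_def using is_walk_relpow[OF xs(1)] by (intro exI[of _ "length xs - 1"]) simp
next
  assume "near E k u v"
  then obtain j where j: "j \<le> k" "(u, v) \<in> E ^^ j" by (auto simp: near_def)
  from relpow_is_walk[OF j(2)] obtain xs
    where "is_walk E xs" "hd xs = u" "last xs = v" "length xs = Suc j" by blast
  then show "dist E u v \<le> enat k"
    unfolding dist_def using j(1) by (intro INF_lower2[of xs]) auto
qed

lemma dist_anti_mono: "H \<subseteq> E \<Longrightarrow> dist E u v \<le> dist H u v"
proof (cases "dist H u v")
  case (enat k)
  assume "H \<subseteq> E"
  have "near H k u v" using enat by (simp flip: dist_le_iff_near)
  from near_mono[OF this \<open>H \<subseteq> E\<close> order_refl] show ?thesis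
    by (simp add: enat dist_le_iff_near)
qed simp

text \<open>All earlier counts are of ordered pairs; merging the two orientations would gain a
  factor 2, which is given away.\<close>

lemma num_edges_le_card: "finite H \<Longrightarrow> num_edges H \<le> card H"
proof -
  assume "finite H"
  have "{{u, v} | u v. (u, v) \<in> H} = (\<lambda>(u, v). {u, v}) ` H" by auto
  with card_image_le[OF \<open>finite H\<close>] show ?thesis by (simp add: num_edges_def)
qed

section \<open>Numerical bounds\<close>

lemma log_and_radius_bounds:
  fixes n :: nat and x :: real
  assumes "1 \<le> n" "1 \<le> x"
  defines "l \<equiv> log 2 (real n + 2)"
  obtains J R :: nat where "n < 2 ^ J" "1 \<le> R" "x \<le> R"
    "real ((4 * J + 2) * R) + 1 \<le> 21 * l * x"
    "real (4 * (2 * J + 1) * (2 * ((4 * J + 2) * R) + 1)) \<le> 840 * l\<^sup>2 * x"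
proof -
  have l: "1 \<le> l" unfolding l_def using assms(1) by (simp add: le_log_iff)
  define J where "J = nat \<lceil>l\<rceil>"
  define R where "R = nat \<lceil>x\<rceil>"
  have J: "l \<le> J" "real J \<le> l + 1" using l by (auto simp: J_def)
  have R: "x \<le> R" "real R \<le> x + 1" using assms(2) by (auto simp: R_def)
  have "real n + 2 = 2 powr l" unfolding l_def by simp
  also have "\<dots> \<le> 2 powr real J" using J(1) by simp
  finally have "real n + 2 \<le> 2 ^ J" by (simp add: powr_realpow)
  then have "real n < 2 ^ J" by linarith
  then have nJ: "n < 2 ^ J" by (metis of_nat_less_iff of_nat_numeral of_nat_power)
  have R1: "1 \<le> R" using R(1) assms(2) by linarith
  have lx: "1 \<le> l * x" using l assms(2) mult_mono[of 1 l 1 x] by simp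
  have "real ((4 * J + 2) * R) = (4 * real J + 2) * real R" by (simp add: algebra_simps)
  \<comment> \<open>Rounding up costs at most 1, so
    \<open>4 * J + 2 \<le> 4 * l + 6 \<le> 10 * l\<close> and \<open>R \<le> 2 * x\<close>; 21 then
    absorbs the added 1. Likewise \<open>4 * (2 * J + 1) \<le> 20 * l\<close> below.\<close>
  also have "\<dots> \<le> (10 * l) * (2 * x)"
    using J R l assms(2) by (intro mult_mono) auto
  finally have D: "real ((4 * J + 2) * R) + 1 \<le> 21 * l * x" using lx by simp
  have "real (4 * (2 * J + 1) * (2 * ((4 * J + 2) * R) + 1)) =
      (4 * (2 * real J + 1)) * (2 * real ((4 * J + 2) * R) + 1)"
    by (simp only: of_nat_mult of_nat_add of_nat_numeral of_nat_1)
  also have "\<dots> \<le> (20 * l) * (42 * l * x)"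
  proof (rule mult_mono)
    show "2 * real ((4 * J + 2) * R) + 1 \<le> 42 * l * x" using D by linarith
  qed (use J l in auto)
  also have "\<dots> = 840 * l\<^sup>2 * x" by (simp add: power2_eq_square)
  finally show thesis by (rule that[OF nJ R1 R(1) D])
qed

text \<open>Large clusters have size at least \<open>y\<close>, the cube root of the threshold at
  radius \<open>n powr \<rho>\<close>. Since the sizes sum to at most \<open>2 * n\<close>, there
  are at most \<open>2 * n / y\<close> of them.\<close>

lemma large_cluster_count:
  fixes \<epsilon> :: real and n :: nat and size :: "'b \<Rightarrow> nat"
  assumes "1 \<le> n" "0 \<le> \<epsilon>" "\<epsilon> \<le> 1/4" "finite \<L>"
    and R: "real n powr (2/3 - 5 * \<epsilon> / 3) \<le> R"
    and large: "\<And>W. W \<in> \<L> \<Longrightarrow> R ^ 4 * (real n powr \<epsilon>)\<^sup>2 < real (size W) ^ 3"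
    and total: "(\<Sum>W\<in>\<L>. size W) \<le> 2 * n"
  shows "real n powr (2/3 - 5 * \<epsilon> / 3) * (real (card \<L>))\<^sup>2 \<le> 4 * real n powr (1 + \<epsilon>)"
proof -
  define \<rho> where "\<rho> = 2/3 - 5 * \<epsilon> / 3"
  define y where "y = real n powr ((4 * \<rho> + 2 * \<epsilon>) / 3)"
  have n: "0 < real n" using assms(1) by simp
  have y: "0 < y" using n by (simp add: y_def)
  have "y ^ 3 = (real n powr \<rho>) ^ 4 * (real n powr \<epsilon>)\<^sup>2"
    using n by (simp add: y_def powr_power add_divide_distrib flip: powr_add)
  also have "\<dots> \<le> R ^ 4 * (real n powr \<epsilon>)\<^sup>2"
    using R by (intro mult_right_mono power_mono) (auto simp: \<rho>_def)
  finally have y3: "y ^ 3 \<le> R ^ 4 * (real n powr \<epsilon>)\<^sup>2" .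
  have "y \<le> real (size W)" if "W \<in> \<L>" for W
  proof -
    have "y ^ 3 < real (size W) ^ 3" using y3 large[OF that] by linarith
    then show ?thesis by (meson less_imp_le of_nat_0_le_iff power_less_imp_less_base)
  qed
  then have "(\<Sum>W\<in>\<L>. y) \<le> (\<Sum>W\<in>\<L>. real (size W))" by (rule sum_mono)
  also have "\<dots> \<le> real (2 * n)" using total by (metis of_nat_le_iff of_nat_sum)
  finally have "real (card \<L>) * y \<le> 2 * real n" by simp
  then have "(real (card \<L>) * y)\<^sup>2 \<le> (2 * real n)\<^sup>2"
    using y by (intro power_mono) auto
  then have "(real (card \<L>))\<^sup>2 * y\<^sup>2 \<le> 4 * (real n)\<^sup>2"
    by (simp add: power_mult_distrib)
  then have "(real (card \<L>))\<^sup>2 \<le> 4 * (real n)\<^sup>2 / y\<^sup>2"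
    using y by (simp add: pos_le_divide_eq)
  then have "real n powr \<rho> * (real (card \<L>))\<^sup>2 \<le> real n powr \<rho> * (4 * (real n)\<^sup>2 / y\<^sup>2)"
    by (intro mult_left_mono) auto
  also have "(real n)\<^sup>2 = real n powr 2" using n by simp
  also have "y\<^sup>2 = real n powr (2 * (4 * \<rho> + 2 * \<epsilon>) / 3)"
    using n by (simp add: y_def powr_power mult_ac)
  also have "real n powr \<rho> * (4 * real n powr 2 / real n powr (2 * (4 * \<rho> + 2 * \<epsilon>) / 3)) =
      4 * real n powr (\<rho> + 2 - 2 * (4 * \<rho> + 2 * \<epsilon>) / 3)"
    by (simp add: powr_add powr_diff)
  \<comment> \<open>The exponent on the left is \<open>8/9 + 13 * \<epsilon> / 9\<close>, which is
    at most \<open>1 + \<epsilon>\<close> exactly when \<open>\<epsilon> \<le> 1/4\<close>.\<close>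
  also have "\<dots> \<le> 4 * real n powr (1 + \<epsilon>)"
    using assms(1,3) by (intro mult_left_mono powr_mono) (auto simp: \<rho>_def field_simps)
  finally show ?thesis by (simp add: \<rho>_def)
qed

text \<open>The backbone is the input of path buying. One constant and one power of the logarithm
  serve both bounds: the edge count determines 1020, the additive error the square.\<close>

lemma additive_spanner_exists:
  fixes \<epsilon> :: real
  assumes \<epsilon>: "0 \<le> \<epsilon>" "\<epsilon> \<le> 1/4" and G: "is_graph n E"
  shows "\<exists>H\<subseteq>E. is_graph n H \<and>
    real (num_edges H) \<le> 1020 * real n powr (1 + \<epsilon>) * (log 2 (real n + 2))\<^sup>2 \<and>
    (\<forall>u<n. \<forall>v<n. dist E u v \<le> dist H u v \<and>
      (\<forall>d. dist E u v = enat d \<longrightarrow> (\<exists>d'. dist H u v = enat d' \<and>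
        real d' \<le> real d + 1020 * real n powr (2/3 - 5 * \<epsilon> / 3) * (log 2 (real n + 2))\<^sup>2)))"
proof (cases "n = 0")
  case True
  with G show ?thesis by (auto simp: is_graph_def num_edges_def)
next
  case False
  define l where "l = log 2 (real n + 2)"
  define x where "x = real n powr (2/3 - 5 * \<epsilon> / 3)"
  define N where "N = real n powr \<epsilon>"
  define P where "P = real n powr (1 + \<epsilon>)"
  have n: "1 \<le> n" "1 \<le> real n" using False by auto
  have x: "1 \<le> x" unfolding x_def using n \<epsilon> by (intro ge_one_powr_ge_zero) auto
  have N: "1 \<le> N" unfolding N_def using n \<epsilon> by (intro ge_one_powr_ge_zero) auto
  have l: "1 \<le> l" unfolding l_def using n by (simp add: le_log_iff)
  have nN: "real n * N = P" using n by (simp add: P_def N_def powr_add)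
  obtain J R where JR: "n < 2 ^ J" "1 \<le> R" "x \<le> real R"
    and D: "real ((4 * J + 2) * R) + 1 \<le> 21 * l * x"
    and err: "real (4 * (2 * J + 1) * (2 * ((4 * J + 2) * R) + 1)) \<le> 840 * l\<^sup>2 * x"
    unfolding l_def using log_and_radius_bounds[OF n(1) x] by blast
  have E: "finite {..<n}" "E \<subseteq> {..<n} \<times> {..<n}" "sym E" "card {..<n} < 2 ^ J"
    using G JR(1) by (auto simp: is_graph_def)
  have finE: "finite E" using E(1,2) by (meson finite_SigmaI finite_subset)
  obtain H0 \<L> where H0: "H0 \<subseteq> E" "sym H0"
    and cH0: "real (card H0) \<le> 4 * card {..<n} + 8 * N * card {..<n}"
    and \<L>: "finite \<L>"
    and large: "\<forall>W\<in>\<L>. real R ^ 4 * N\<^sup>2 < real (card (nbhd E R W)) ^ 3"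
    and total: "(\<Sum>W\<in>\<L>. card (nbhd E R W)) \<le> 2 * card {..<n}"
    and diam: "\<forall>W\<in>\<L>. \<forall>x\<in>W. \<forall>y\<in>W. near E ((4 * J + 2) * R) x y"
    and stretch: "\<forall>x y. (x, y) \<in> E \<longrightarrow> near H0 (2 * J) x y"
    and confined: "confined E H0 ((4 * J + 2) * R) \<L>"
    using backbone[OF E JR(2) N] by (elim exE conjE)
  obtain H where H: "H \<subseteq> E" "sym H"
    and cH: "card H \<le> card H0 + 12 * ((4 * J + 2) * R + 1) * (card \<L>)\<^sup>2"
    and add: "\<forall>k u v. near E k u v \<longrightarrow>
      near H (k + 4 * (2 * J + 1) * (2 * ((4 * J + 2) * R) + 1)) u v"
    using path_buying[OF finE E(3) H0 \<L> diam stretch confined]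
    by (elim exE conjE)
  have "real (card H) \<le> real (card H0 + 12 * ((4 * J + 2) * R + 1) * (card \<L>)\<^sup>2)"
    using cH by (rule of_nat_mono)
  also have "\<dots> = real (card H0) + 12 * (real ((4 * J + 2) * R) + 1) * (real (card \<L>))\<^sup>2"
    by simp
  also have "\<dots> \<le> 12 * P + 12 * (21 * l * x) * (real (card \<L>))\<^sup>2"
  proof (intro add_mono mult_right_mono mult_left_mono D)
    have "real n \<le> P" using nN N n by (metis mult.right_neutral mult_left_mono of_nat_0_le_iff)
    then show "real (card H0) \<le> 12 * P" using cH0 nN by (simp add: algebra_simps)
  qed auto
  also have "\<dots> = 12 * P + 252 * l * (x * (real (card \<L>))\<^sup>2)" by simp
  also have "\<dots> \<le> 12 * P + 252 * l * (4 * P)"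
    unfolding x_def P_def using l total large[unfolded N_def, rule_format] JR(3)[unfolded x_def]
    by (intro add_left_mono mult_left_mono large_cluster_count[OF n(1) \<epsilon> \<L>]) auto
  \<comment> \<open>\<open>252 = 12 * 21\<close> comes from the diameter bound, and
    \<open>12 + 252 * 4 = 1020\<close>.\<close>
  also have "\<dots> \<le> 1020 * P * l\<^sup>2"
  proof -
    have "l \<le> l\<^sup>2" "1 \<le> l\<^sup>2" using l by (auto simp: self_le_power)
    moreover have "0 \<le> P" by (simp add: P_def)
    ultimately have "P * l \<le> P * l\<^sup>2" "P * 1 \<le> P * l\<^sup>2" by (simp_all only: mult_left_mono)
    then show ?thesis by (simp add: mult_ac)
  qed
  finally have "real (card H) \<le> 1020 * P * l\<^sup>2" .
  moreover have "num_edges H \<le> card H"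
    using finite_subset[OF H(1) finE] by (rule num_edges_le_card)
  ultimately have edges: "real (num_edges H) \<le> 1020 * P * l\<^sup>2" by linarith
  have "\<exists>d'. dist H u v = enat d' \<and> real d' \<le> real d + 1020 * x * l\<^sup>2"
    if "dist E u v = enat d" for u v d
  proof -
    have "near E d u v" using that by (simp flip: dist_le_iff_near)
    from add[rule_format, OF this] have *: "dist H u v \<le> enat (d + 4 * (2 * J + 1) * (2 * ((4 * J + 2) * R) + 1))"
      by (simp only: dist_le_iff_near)
    then obtain d' where d': "dist H u v = enat d'" by (cases "dist H u v") auto
    with * have "d' \<le> d + 4 * (2 * J + 1) * (2 * ((4 * J + 2) * R) + 1)" by (simp only: enat_ord_simps)
    then have "real d' \<le> real d + real (4 * (2 * J + 1) * (2 * ((4 * J + 2) * R) + 1))"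
      by (metis of_nat_add of_nat_mono)
    also have "\<dots> \<le> real d + 1020 * x * l\<^sup>2"
    proof -
      have "840 * l\<^sup>2 * x = 840 * (x * l\<^sup>2)" "1020 * x * l\<^sup>2 = 1020 * (x * l\<^sup>2)" "0 \<le> x * l\<^sup>2"
        using x by simp_all
      with err show ?thesis by linarith
    qed
    finally show ?thesis using d' by blast
  qed
  moreover have "is_graph n H"
    using G H by (auto simp: is_graph_def irrefl_def)
  ultimately show ?thesis
    using H(1) edges dist_anti_mono[OF H(1)] unfolding x_def P_def l_def
    by (intro exI[of _ H]) blast
qed

theorem theorem3:
  shows "\<forall>\<epsilon>::real. 0 \<le> \<epsilon> \<and> \<epsilon> \<le> 1/4 \<longrightarrow>
    (\<exists>(C::real) (k::nat). C > 0 \<and>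
      (\<forall>(n::nat) (E::(nat \<times> nat) set). is_graph n E \<longrightarrow>
        (\<exists>H. H \<subseteq> E \<and> is_graph n H \<and>
           real (num_edges H) \<le> C * real n powr (1 + \<epsilon>) * (log 2 (real n + 2)) ^ k \<and>
           (\<forall>u<n. \<forall>v<n.
              dist E u v \<le> dist H u v \<and>
              (\<forall>d. dist E u v = enat d \<longrightarrow>
                 (\<exists>d'. dist H u v = enat d' \<and>
                    real d' \<le> real d + C * real n powr (2/3 - 5 * \<epsilon> / 3) * (log 2 (real n + 2)) ^ k))))))"
proof (intro allI impI)
  fix \<epsilon> :: real assume "0 \<le> \<epsilon> \<and> \<epsilon> \<le> 1/4"
  then have \<epsilon>: "0 \<le> \<epsilon>" "\<epsilon> \<le> 1/4" by auto
  show "\<exists>(C::real) (k::nat). C > 0 \<and>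
      (\<forall>(n::nat) (E::(nat \<times> nat) set). is_graph n E \<longrightarrow>
        (\<exists>H. H \<subseteq> E \<and> is_graph n H \<and>
           real (num_edges H) \<le> C * real n powr (1 + \<epsilon>) * (log 2 (real n + 2)) ^ k \<and>
           (\<forall>u<n. \<forall>v<n.
              dist E u v \<le> dist H u v \<and>
              (\<forall>d. dist E u v = enat d \<longrightarrow>
                 (\<exists>d'. dist H u v = enat d' \<and>
                    real d' \<le> real d + C * real n powr (2/3 - 5 * \<epsilon> / 3) * (log 2 (real n + 2)) ^ k)))))"
    \<comment> \<open>The same witnesses serve every \<open>\<epsilon>\<close>, not only every
      graph.\<close>
    by (intro exI[of _ "1020::real"] exI[of _ "2::nat"]) (simp add: additive_spanner_exists[OF \<epsilon>])
qed

end
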